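(* A metric space is a $\operatorname{CAT}(0)$-space if and only if it is Ptolemy and Busemann convex.
   Context: Write $|xy|$ for the distance between points $x,y$ of a metric space. A metric space $X$ is Ptolemy if $|xy|\,|uv| \le |xu|\,|yv| + |xv|\,|yu|$ for all $x,y,u,v\in X$. A metric space $X$ is geodesic if any two points $x,y\in X$ can be joined by a geodesic path, i.e. there is an isometric embedding $\gamma:[0,|xy|]\to X$ with $\gamma(0)=x$, $\gamma(|xy|)=y$. Geodesics are parameterized affinely, i.e. proportionally to arclength. A $\operatorname{CAT}(0)$-space is a geodesic metric space in which all geodesic triangles are not thicker than their comparison triangles in the Euclidean plane (the usual definition; completeness is not required). A geodesic metric space $X$ is Busemann convex if for any two affinely parameterized geodesics $\alpha,\beta: I\to X$ defined on the same interval $I$, the map $t\mapsto |\alpha(t)\beta(t)|$ is convex. *)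

theory Defs
  imports "HOL-Analysis.Analysis"
begin

text \<open>A metric space is given as a subset \<open>X\<close> of a type of class \<open>metric_space\<close>, with the
  restricted distance function. Paths are functions \<open>real \<Rightarrow> 'a\<close>, of which only the values on the
  interval in question are relevant.\<close>

definition ptolemy :: "'a::metric_space set \<Rightarrow> bool" where
  "ptolemy X \<longleftrightarrow>
     (\<forall>x\<in>X. \<forall>y\<in>X. \<forall>u\<in>X. \<forall>v\<in>X. dist x y * dist u v \<le> dist x u * dist y v + dist x v * dist y u)"

definition geodesic_path :: "'a::metric_space set \<Rightarrow> 'a \<Rightarrow> 'a \<Rightarrow> (real \<Rightarrow> 'a) \<Rightarrow> bool" where
  "geodesic_path X x y \<gamma> \<longleftrightarrow>
     \<gamma> \<in> {0..dist x y} \<rightarrow> X \<and>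
     (\<forall>s\<in>{0..dist x y}. \<forall>t\<in>{0..dist x y}. dist (\<gamma> s) (\<gamma> t) = \<bar>s - t\<bar>) \<and>
     \<gamma> 0 = x \<and> \<gamma> (dist x y) = y"

definition geodesic_space :: "'a::metric_space set \<Rightarrow> bool" where
  "geodesic_space X \<longleftrightarrow> (\<forall>x\<in>X. \<forall>y\<in>X. \<exists>\<gamma>. geodesic_path X x y \<gamma>)"

text \<open>The factor \<open>c\<close> may be zero: constant paths are affinely parameterized geodesics, joining a
  point to itself.\<close>

definition affine_geodesic :: "'a::metric_space set \<Rightarrow> real set \<Rightarrow> (real \<Rightarrow> 'a) \<Rightarrow> bool" where
  "affine_geodesic X I \<alpha> \<longleftrightarrow>
     \<alpha> \<in> I \<rightarrow> X \<and> (\<exists>c\<ge>0. \<forall>s\<in>I. \<forall>t\<in>I. dist (\<alpha> s) (\<alpha> t) = c * \<bar>s - t\<bar>)"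

definition busemann_convex :: "'a::metric_space set \<Rightarrow> bool" where
  "busemann_convex X \<longleftrightarrow>
     geodesic_space X \<and>
     (\<forall>I \<alpha> \<beta>. is_interval I \<longrightarrow> affine_geodesic X I \<alpha> \<longrightarrow> affine_geodesic X I \<beta> \<longrightarrow>
        convex_on I (\<lambda>t. dist (\<alpha> t) (\<beta> t)))"

definition geodesic_segment :: "'a::metric_space set \<Rightarrow> 'a \<Rightarrow> 'a \<Rightarrow> 'a set \<Rightarrow> bool" where
  "geodesic_segment X x y S \<longleftrightarrow> (\<exists>\<gamma>. geodesic_path X x y \<gamma> \<and> S = \<gamma> ` {0..dist x y})"

text \<open>Triangles are indexed by the three-element type \<open>3\<close>, whose addition is modulo 3, so that the
  side \<open>S i\<close> joins the vertex \<open>v i\<close> to the cyclically next vertex \<open>v (i + 1)\<close>.\<close>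

definition geodesic_triangle ::
    "'a::metric_space set \<Rightarrow> (3 \<Rightarrow> 'a) \<Rightarrow> (3 \<Rightarrow> 'a set) \<Rightarrow> bool" where
  "geodesic_triangle X v S \<longleftrightarrow>
     (\<forall>i. v i \<in> X) \<and> (\<forall>i. geodesic_segment X (v i) (v (i + 1)) (S i))"

definition comparison_triangle :: "(3 \<Rightarrow> 'a::metric_space) \<Rightarrow> (3 \<Rightarrow> real ^ 2) \<Rightarrow> bool" where
  "comparison_triangle v w \<longleftrightarrow> (\<forall>i j. dist (w i) (w j) = dist (v i) (v j))"

definition comparison_point ::
    "(3 \<Rightarrow> 'a::metric_space) \<Rightarrow> (3 \<Rightarrow> real ^ 2) \<Rightarrow> 3 \<Rightarrow> 'a \<Rightarrow> real ^ 2 \<Rightarrow> bool" where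
  "comparison_point v w i p p' \<longleftrightarrow>
     p' \<in> closed_segment (w i) (w (i + 1)) \<and> dist (w i) p' = dist (v i) p"

text \<open>A comparison triangle always exists and is unique up to isometry of the plane, so it does not
  matter whether the comparison is required for one or for all of them.\<close>

definition CAT0_space :: "'a::metric_space set \<Rightarrow> bool" where
  "CAT0_space X \<longleftrightarrow>
     geodesic_space X \<and>
     (\<forall>v S w. geodesic_triangle X v S \<longrightarrow> comparison_triangle v w \<longrightarrow>
        (\<forall>i j. \<forall>p\<in>S i. \<forall>q\<in>S j. \<forall>p' q'.
           comparison_point v w i p p' \<longrightarrow> comparison_point v w j q q' \<longrightarrow>
           dist p q \<le> dist p' q'))"

end

theory Submission
  imports Defs
begin

text \<open>Both sides are compared with Stewart's inequality
  \<open>|xm|\<^sup>2 \<le> (1 - l) |xy|\<^sup>2 + l |xz|\<^sup>2 - l (1 - l) |yz|\<^sup>2\<close> for the point \<open>m\<close> at fraction \<open>l\<close> of the way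
  from \<open>y\<close> to \<open>z\<close>. Two applications of it bound the distance of points on two sides of a triangle,
  which yields the \<open>CAT(0)\<close> comparison and Busemann convexity; Ptolemy's inequality follows by
  applying it to the points of the two diagonals of a quadrilateral at which the diagonals of a
  cyclic quadrilateral with the same sides would meet.

  For the converse, let \<open>c\<close> be a geodesic, \<open>p\<close> a point and \<open>h t = |p c(t)|\<close>. By Busemann convexity the
  configuration formed by \<open>c\<close> and the geodesics from \<open>c\<close> to \<open>p\<close> has, after rescaling at \<open>c(t)\<close>, limit
  distances along \<open>c\<close> and one such geodesic; these depend upper semicontinuously on \<open>t\<close>. At a generic
  \<open>t\<close> (Baire) they are continuous, and then the whole rescaled configuration converges to a half-plane
  with a seminorm. The seminorm inherits Ptolemy's inequality, hence comes from an inner product, so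
  that the first variations of the distance along \<open>c\<close> and along the geodesic to \<open>p\<close> are given by the
  same cosine. Ptolemy's inequality for \<open>c(s)\<close>, \<open>c(t)\<close> and nearby points on the geodesics to \<open>p\<close> then
  shows that the derivative of \<open>h\<^sup>2 / 2\<close> grows with slope at least 1, which is Stewart's inequality.\<close>

section \<open>Seminorms satisfying Ptolemy's inequality\<close>

locale ptolemy_seminorm =
  fixes N :: "'v::real_vector \<Rightarrow> real"
  assumes triangle: "N (x + y) \<le> N x + N y"
    and scale: "N (s *\<^sub>R x) = \<bar>s\<bar> * N x"
    and ptolemy: "N (x - y) * N (u - v) \<le> N (x - u) * N (y - v) + N (x - v) * N (y - u)"
begin

lemma minus [simp]: "N (- x) = N x"
  using scale[of "-1" x] by simp

lemma commute: "N (x - y) = N (y - x)"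
  using minus[of "x - y"] by simp

lemma zero [simp]: "N 0 = 0"
  using scale[of 0 0] by simp

lemma nonneg [simp]: "0 \<le> N x"
  using triangle[of x "- x"] by simp

lemma diff_bound: "\<bar>N x - N y\<bar> \<le> N (x - y)"
  using triangle[of "x - y" y] triangle[of "y - x" x] commute[of x y] by simp

text \<open>The vector space carries no topology, so continuity is stated in the coordinates of a
  plane, where \<open>N\<close> is Lipschitz by \<open>diff_bound\<close>. The compactness and
  intermediate value arguments below rest on it.\<close>

lemma continuous_plane: "continuous_on UNIV (\<lambda>z. N (fst z *\<^sub>R v + snd z *\<^sub>R w))"
proof (rule lipschitz_on_continuous_on)
  show "(N v + N w)-lipschitz_on UNIV (\<lambda>z. N (fst z *\<^sub>R v + snd z *\<^sub>R w))"
  proof (rule lipschitz_onI)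
    fix z z' :: "real \<times> real"
    have "\<bar>N (fst z *\<^sub>R v + snd z *\<^sub>R w) - N (fst z' *\<^sub>R v + snd z' *\<^sub>R w)\<bar>
        \<le> N ((fst z *\<^sub>R v + snd z *\<^sub>R w) - (fst z' *\<^sub>R v + snd z' *\<^sub>R w))"
      by (rule diff_bound)
    also have "\<dots> = N ((fst z - fst z') *\<^sub>R v + (snd z - snd z') *\<^sub>R w)"
      by (simp add: algebra_simps)
    also have "\<dots> \<le> \<bar>fst z - fst z'\<bar> * N v + \<bar>snd z - snd z'\<bar> * N w"
      by (metis triangle scale)
    also have "\<dots> \<le> dist z z' * N v + dist z z' * N w"
      using dist_fst_le[of z z'] dist_snd_le[of z z']
      by (intro add_mono mult_right_mono) (auto simp: dist_real_def)
    finally show "dist (N (fst z *\<^sub>R v + snd z *\<^sub>R w)) (N (fst z' *\<^sub>R v + snd z' *\<^sub>R w))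
        \<le> (N v + N w) * dist z z'"
      by (simp add: dist_real_def algebra_simps)
  qed simp
qed

text \<open>Ptolemy's inequality for the parallelogram with vertices \<open>0\<close>,
  \<open>p\<close>, \<open>p + q\<close>, \<open>q\<close>.\<close>

lemma parallelogram: "N (p + q) * N (p - q) \<le> (N p)\<^sup>2 + (N q)\<^sup>2"
  using ptolemy[of 0 "p + q" p q] minus[of "p + q"] by (simp add: power2_eq_square)

text \<open>Ptolemy's inequality for a trapezoid with parallel sides \<open>(s + c) e\<close> and \<open>(s - c) e\<close>, diagonals
  \<open>s (e \<plusminus> f)\<close> and legs \<open>c e \<plusminus> s f\<close>.\<close>

lemma trapezoid:
  assumes "0 \<le> c" "c \<le> s"
  shows "s\<^sup>2 * (N (e + f) * N (e - f)) \<le> (s\<^sup>2 - c\<^sup>2) * (N e)\<^sup>2 + N (c *\<^sub>R e + s *\<^sub>R f) * N (c *\<^sub>R e - s *\<^sub>R f)"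
proof -
  have 1: "N (0 - (s *\<^sub>R e + s *\<^sub>R f)) = s * N (e + f)"
    using scale[of "s" "e + f"] assms minus[of "s *\<^sub>R e + s *\<^sub>R f"] by (simp add: scaleR_add_right)
  have "(s + c) *\<^sub>R e - (c *\<^sub>R e + s *\<^sub>R f) = s *\<^sub>R (e - f)"
    by (simp add: algebra_simps)
  then have 2: "N ((s + c) *\<^sub>R e - (c *\<^sub>R e + s *\<^sub>R f)) = s * N (e - f)"
    using scale[of "s" "e - f"] assms by simp
  have 3: "N (0 - (s + c) *\<^sub>R e) = (s + c) * N e"
    using scale[of "s + c" e] assms minus[of "(s + c) *\<^sub>R e"] by simp
  have "(s *\<^sub>R e + s *\<^sub>R f) - (c *\<^sub>R e + s *\<^sub>R f) = (s - c) *\<^sub>R e"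
    by (simp add: algebra_simps)
  then have 4: "N ((s *\<^sub>R e + s *\<^sub>R f) - (c *\<^sub>R e + s *\<^sub>R f)) = (s - c) * N e"
    using scale[of "s - c" e] assms by simp
  have 5: "N (0 - (c *\<^sub>R e + s *\<^sub>R f)) = N (c *\<^sub>R e + s *\<^sub>R f)"
    by (metis diff_0 minus)
  have "(s *\<^sub>R e + s *\<^sub>R f) - (s + c) *\<^sub>R e = - (c *\<^sub>R e - s *\<^sub>R f)"
    by (simp add: algebra_simps)
  then have 6: "N ((s *\<^sub>R e + s *\<^sub>R f) - (s + c) *\<^sub>R e) = N (c *\<^sub>R e - s *\<^sub>R f)"
    by (metis minus)
  have "s * N (e + f) * (s * N (e - f)) \<le> (s + c) * N e * ((s - c) * N e)
      + N (c *\<^sub>R e + s *\<^sub>R f) * N (c *\<^sub>R e - s *\<^sub>R f)"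
    using ptolemy[of 0 "s *\<^sub>R e + s *\<^sub>R f" "(s + c) *\<^sub>R e" "c *\<^sub>R e + s *\<^sub>R f"] unfolding 1 2 3 4 5 6 .
  then show ?thesis
    by (simp add: algebra_simps power2_eq_square)
qed

text \<open>\<open>parallelogram\<close> gives the upper bound and \<open>trapezoid\<close> the
  lower one, with \<open>e\<close> and \<open>f\<close> exchanged when \<open>c\<close> exceeds
  \<open>s\<close>.\<close>

lemma conjugate_product:
  assumes e: "N e = r" and f: "N f = r"
    and ef: "(N (e + f))\<^sup>2 = 2 * r\<^sup>2" "(N (e - f))\<^sup>2 = 2 * r\<^sup>2"
  shows "N (c *\<^sub>R e + s *\<^sub>R f) * N (c *\<^sub>R e - s *\<^sub>R f) = r\<^sup>2 * (c\<^sup>2 + s\<^sup>2)"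
proof -
  have le: "N (c *\<^sub>R e + s *\<^sub>R f) * N (c *\<^sub>R e - s *\<^sub>R f) \<le> r\<^sup>2 * (c\<^sup>2 + s\<^sup>2)" for c s
    using parallelogram[of "c *\<^sub>R e" "s *\<^sub>R f"] by (simp add: scale e f power_mult_distrib algebra_simps)
  have "N (e + f) = N (e - f)"
    using ef by (metis nonneg power2_eq_imp_eq)
  then have pr: "N (e + f) * N (e - f) = 2 * r\<^sup>2"
    using ef by (simp add: power2_eq_square)
  have pr': "N (f + e) * N (f - e) = 2 * r\<^sup>2"
    using pr by (simp add: add.commute commute[of f e])
  have ge1: "r\<^sup>2 * (c\<^sup>2 + s\<^sup>2) \<le> N (c *\<^sub>R e + s *\<^sub>R f) * N (c *\<^sub>R e - s *\<^sub>R f)" if "0 \<le> c" "0 \<le> s" for c s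
  proof (cases "c \<le> s")
    case True
    show ?thesis using trapezoid[OF \<open>0 \<le> c\<close> True, of e f] unfolding pr e by (simp add: algebra_simps)
  next
    case False
    have sw: "N (s *\<^sub>R f + c *\<^sub>R e) * N (s *\<^sub>R f - c *\<^sub>R e) = N (c *\<^sub>R e + s *\<^sub>R f) * N (c *\<^sub>R e - s *\<^sub>R f)"
      by (metis add.commute commute)
    then show ?thesis using trapezoid[OF \<open>0 \<le> s\<close>, of c f e] False unfolding pr' f sw by (simp add: algebra_simps)
  qed
  \<comment> \<open>Sign changes of the coefficients at most exchange the two factors, up to the
    sign of the vectors.\<close>
  have abs1: "N (\<bar>c\<bar> *\<^sub>R e + \<bar>s\<bar> *\<^sub>R f) * N (\<bar>c\<bar> *\<^sub>R e - \<bar>s\<bar> *\<^sub>R f)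
    = N (c *\<^sub>R e + s *\<^sub>R f) * N (c *\<^sub>R e - s *\<^sub>R f)"
  proof -
    have *: "N (- (c *\<^sub>R e) + s *\<^sub>R f) = N (c *\<^sub>R e - s *\<^sub>R f)" 
      using minus[of "c *\<^sub>R e - s *\<^sub>R f"] by (simp add: algebra_simps)
    have **: "N (- (c *\<^sub>R e) - s *\<^sub>R f) = N (c *\<^sub>R e + s *\<^sub>R f)"
      using minus[of "c *\<^sub>R e + s *\<^sub>R f"] by (simp add: algebra_simps)
    show ?thesis using * ** by (auto simp: abs_if mult.commute)
  qed
  show ?thesis using le[of c s] ge1[of "\<bar>c\<bar>" "\<bar>s\<bar>"] abs1 by simp
qed

text \<open>In coordinates \<open>N\<close> is invariant under quarter turns. Take a minimum point
  of \<open>N\<close> on the Euclidean unit circle: the parallelogram on multiples of it and of its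
  quarter turn bounds a product from above, while minimality bounds each factor from below. The
  bounds agree, so \<open>N\<close> is a multiple of the Euclidean norm.\<close>

lemma euclidean_basis:
  assumes e: "N e = 1" and f: "N f = 1" and ef: "N (e + f) = N (e - f)"
  shows "(N (x *\<^sub>R e + y *\<^sub>R f))\<^sup>2 = x\<^sup>2 + y\<^sup>2"
proof -
  have two: "(N (e + f))\<^sup>2 = 2"
  proof (rule antisym)
    have "N ((e + f) + (e - f)) * N ((e + f) - (e - f)) = 4"
    proof -
      have "(e + f) + (e - f) = 2 *\<^sub>R e" "(e + f) - (e - f) = 2 *\<^sub>R f" by (simp_all add: scaleR_2)
      then show ?thesis using scale[of 2 e] scale[of 2 f] e f by simp
    qed
    then show "2 \<le> (N (e + f))\<^sup>2" using parallelogram[of "e + f" "e - f"] ef by simp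
    show "(N (e + f))\<^sup>2 \<le> 2" using parallelogram[of e f] e f ef by (simp add: power2_eq_square)
  qed
  define F where "F x y = N (x *\<^sub>R e + y *\<^sub>R f)" for x y
  have F_nonneg: "0 \<le> F x y" for x y by (simp add: F_def)
  have F1: "F x y * F x (- y) = x\<^sup>2 + y\<^sup>2" for x y
    using conjugate_product[OF e f, of x y] two ef by (simp add: F_def)
  \<comment> \<open>\<open>conjugate_product\<close> for the pair \<open>e + f\<close>,
    \<open>e - f\<close>, whose sum and difference are twice \<open>e\<close> and twice
    \<open>f\<close>.\<close>
  have F2: "F x y * F y x = x\<^sup>2 + y\<^sup>2" for x y
  proof -
    have a: "(N (e + f + (e - f)))\<^sup>2 = 2 * (N (e + f))\<^sup>2" "(N (e + f - (e - f)))\<^sup>2 = 2 * (N (e + f))\<^sup>2"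
    proof -
      have "(e + f) + (e - f) = 2 *\<^sub>R e" "(e + f) - (e - f) = 2 *\<^sub>R f" by (simp_all add: scaleR_2)
      then show "(N (e + f + (e - f)))\<^sup>2 = 2 * (N (e + f))\<^sup>2" "(N (e + f - (e - f)))\<^sup>2 = 2 * (N (e + f))\<^sup>2"
        using scale[of 2 e] scale[of 2 f] e f two by simp_all
    qed
    have "N (((x + y)/2) *\<^sub>R (e + f) + ((x - y)/2) *\<^sub>R (e - f)) * N (((x + y)/2) *\<^sub>R (e + f) - ((x - y)/2) *\<^sub>R (e - f))
       = (N (e + f))\<^sup>2 * (((x + y)/2)\<^sup>2 + ((x - y)/2)\<^sup>2)"
      by (rule conjugate_product[OF refl ef[symmetric] a])
    moreover have "((x + y)/2) *\<^sub>R (e + f) + ((x - y)/2) *\<^sub>R (e - f) = x *\<^sub>R e + y *\<^sub>R f"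
    proof -
      have "((x + y)/2) *\<^sub>R (e + f) + ((x - y)/2) *\<^sub>R (e - f)
        = ((x + y)/2 + (x - y)/2) *\<^sub>R e + ((x + y)/2 - (x - y)/2) *\<^sub>R f"
        by (simp only: algebra_simps)
      then show ?thesis by (simp add: field_simps)
    qed
    moreover have "((x + y)/2) *\<^sub>R (e + f) - ((x - y)/2) *\<^sub>R (e - f) = y *\<^sub>R e + x *\<^sub>R f"
    proof -
      have "((x + y)/2) *\<^sub>R (e + f) - ((x - y)/2) *\<^sub>R (e - f)
        = ((x + y)/2 - (x - y)/2) *\<^sub>R e + ((x + y)/2 + (x - y)/2) *\<^sub>R f"
        by (simp only: algebra_simps)
      then show ?thesis by (simp add: field_simps)
    qed
    moreover have "2 * (((x + y)/2)\<^sup>2 + ((x - y)/2)\<^sup>2) = x\<^sup>2 + y\<^sup>2"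
      by (simp add: field_simps power2_eq_square)
    ultimately show ?thesis by (simp add: F_def two)
  qed
  have pos: "0 < F x y" if "x \<noteq> 0 \<or> y \<noteq> 0" for x y
  proof -
    have "0 < x\<^sup>2 + y\<^sup>2" using that by (simp add: sum_power2_gt_zero_iff)
    then have "F x y \<noteq> 0" using F1[of x y] by auto
    then show ?thesis using F_nonneg[of x y] by simp
  qed
  \<comment> \<open>\<open>F1\<close> and \<open>F2\<close> at \<open>(x, - y)\<close> share a
    positive factor, which cancels.\<close>
  have rot: "F (- y) x = F x y" for x y
  proof (cases "x = 0 \<and> y = 0")
    case False
    then have "F x (- y) > 0" using pos[of x "- y"] by auto
    moreover have "F x (- y) * F (- y) x = F x (- y) * F x y"
      using F2[of x "- y"] F1[of x "- y"] by simp
    ultimately show ?thesis by simp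
  qed (simp add: F_def)
  have F_scale: "F (s * x) (s * y) = \<bar>s\<bar> * F x y" for s x y
    using scale[of s "x *\<^sub>R e + y *\<^sub>R f"] by (simp add: F_def scaleR_add_right)
  have cont: "continuous_on (sphere 0 1) (\<lambda>z. F (fst z) (snd z))"
    unfolding F_def using continuous_plane continuous_on_subset by blast
  have ne: "sphere (0::real \<times> real) 1 \<noteq> {}"
    by (metis empty_iff mem_sphere_0 norm_Pair1 norm_one)
  obtain z0 where z0: "z0 \<in> sphere 0 1" "\<And>z. z \<in> sphere 0 1 \<Longrightarrow> F (fst z0) (snd z0) \<le> F (fst z) (snd z)"
    using continuous_attains_inf[OF compact_sphere ne cont] by blast
  define a b m where "a = fst z0" and "b = snd z0" and "m = F a b"
  have ab: "a\<^sup>2 + b\<^sup>2 = 1"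
    using z0(1) by (simp add: norm_prod_def a_def b_def)
  have lower: "m * sqrt (x\<^sup>2 + y\<^sup>2) \<le> F x y" for x y
  proof (cases "x = 0 \<and> y = 0")
    case False
    define r where "r = sqrt (x\<^sup>2 + y\<^sup>2)"
    have r: "r > 0" using False by (auto simp: r_def sum_power2_gt_zero_iff)
    have r2: "r\<^sup>2 = x\<^sup>2 + y\<^sup>2" by (simp add: r_def)
    have "(x / r, y / r) \<in> sphere 0 1"
      using r r2[symmetric] by (simp add: norm_prod_def power_divide flip: add_divide_distrib)
    then have "m \<le> F (x / r) (y / r)"
      using z0(2)[of "(x / r, y / r)"] by (simp add: m_def a_def b_def)
    moreover have "F x y = r * F (x / r) (y / r)"
      using F_scale[of r "x / r" "y / r"] r by simp
    ultimately show ?thesis using r by (simp add: r_def[symmetric] mult.commute)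
  qed (simp add: F_def)
  have m_pos: "0 < m" using ab pos[of a b] unfolding m_def by fastforce
  \<comment> \<open>The argument is \<open>s\<close> times the minimum point \<open>(a, b)\<close>
    plus \<open>t\<close> times its quarter turn \<open>(- b, a)\<close>, at both of which
    \<open>F\<close> equals \<open>m\<close>.\<close>
  have eq: "F (a * s - b * t) (b * s + a * t) = m * sqrt (s\<^sup>2 + t\<^sup>2)" for s t
  proof -
    have "F (a * s - b * t) (b * s + a * t) * F (a * s + b * t) (b * s - a * t)
       \<le> (F (s * a) (s * b))\<^sup>2 + (F (t * - b) (t * a))\<^sup>2"
    proof -
      have *: "(a * s - b * t) *\<^sub>R e + (b * s + a * t) *\<^sub>R f
         = ((s * a) *\<^sub>R e + (s * b) *\<^sub>R f) + ((t * - b) *\<^sub>R e + (t * a) *\<^sub>R f)"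
        "(a * s + b * t) *\<^sub>R e + (b * s - a * t) *\<^sub>R f
         = ((s * a) *\<^sub>R e + (s * b) *\<^sub>R f) - ((t * - b) *\<^sub>R e + (t * a) *\<^sub>R f)"
        by (simp_all add: algebra_simps)
      show ?thesis unfolding F_def * by (rule parallelogram)
    qed
    also have "\<dots> = m\<^sup>2 * (s\<^sup>2 + t\<^sup>2)"
      unfolding F_scale using rot[where x=a and y=b] by (simp add: m_def power_mult_distrib algebra_simps)
    finally have up: "F (a * s - b * t) (b * s + a * t) * F (a * s + b * t) (b * s - a * t)
      \<le> m\<^sup>2 * (s\<^sup>2 + t\<^sup>2)" .
    have sq: "(a * s - b * t)\<^sup>2 + (b * s + a * t)\<^sup>2 = s\<^sup>2 + t\<^sup>2" "(a * s + b * t)\<^sup>2 + (b * s - a * t)\<^sup>2 = s\<^sup>2 + t\<^sup>2"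
    proof -
      have "(a * s - b * t)\<^sup>2 + (b * s + a * t)\<^sup>2 = (a\<^sup>2 + b\<^sup>2) * (s\<^sup>2 + t\<^sup>2)"
        "(a * s + b * t)\<^sup>2 + (b * s - a * t)\<^sup>2 = (a\<^sup>2 + b\<^sup>2) * (s\<^sup>2 + t\<^sup>2)"
        by (simp_all add: algebra_simps power2_eq_square)
      then show "(a * s - b * t)\<^sup>2 + (b * s + a * t)\<^sup>2 = s\<^sup>2 + t\<^sup>2" "(a * s + b * t)\<^sup>2 + (b * s - a * t)\<^sup>2 = s\<^sup>2 + t\<^sup>2"
        by (simp_all add: ab)
    qed
    define q where "q = m * sqrt (s\<^sup>2 + t\<^sup>2)"
    have q2: "q * q = m\<^sup>2 * (s\<^sup>2 + t\<^sup>2)" by (simp add: q_def power2_eq_square algebra_simps real_sqrt_mult_self)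
    have q0: "0 \<le> q" using m_pos by (simp add: q_def)
    have l: "q \<le> F (a * s - b * t) (b * s + a * t)" "q \<le> F (a * s + b * t) (b * s - a * t)"
      using lower[of "a * s - b * t" "b * s + a * t"] lower[of "a * s + b * t" "b * s - a * t"] sq
      by (simp_all add: q_def)
    show ?thesis
    proof (rule antisym)
      show "m * sqrt (s\<^sup>2 + t\<^sup>2) \<le> F (a * s - b * t) (b * s + a * t)" using l by (simp add: q_def)
      show "F (a * s - b * t) (b * s + a * t) \<le> m * sqrt (s\<^sup>2 + t\<^sup>2)"
      proof (cases "q = 0")
        case True
        then have "s = 0 \<and> t = 0" using m_pos by (simp add: q_def sum_power2_eq_zero_iff)
        then show ?thesis by (simp add: F_def)
      next
        case False
        then have "q > 0" using q0 by simp
        have "F (a * s - b * t) (b * s + a * t) * q \<le> F (a * s - b * t) (b * s + a * t) * F (a * s + b * t) (b * s - a * t)"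
          using l F_nonneg by (intro mult_left_mono)
        also have "\<dots> \<le> q * q" using up q2 by simp
        finally show ?thesis using \<open>q > 0\<close> unfolding q_def[symmetric] by simp
      qed
    qed
  qed
  \<comment> \<open>Every vector is of the form treated in \<open>eq\<close>: its coordinates with
    respect to \<open>(a, b)\<close> and \<open>(- b, a)\<close> are substituted.\<close>
  have gen: "F x y = m * sqrt (x\<^sup>2 + y\<^sup>2)" for x y
  proof -
    have 1: "a * (a * x + b * y) - b * (a * y - b * x) = (a\<^sup>2 + b\<^sup>2) * x"
      "b * (a * x + b * y) + a * (a * y - b * x) = (a\<^sup>2 + b\<^sup>2) * y"
      "(a * x + b * y)\<^sup>2 + (a * y - b * x)\<^sup>2 = (a\<^sup>2 + b\<^sup>2) * (x\<^sup>2 + y\<^sup>2)"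
      by (simp_all add: algebra_simps power2_eq_square)
    show ?thesis using eq[of "a * x + b * y" "a * y - b * x"] 1 ab by simp
  qed
  have "m = 1" using gen[of 1 0] by (simp add: F_def e)
  then show ?thesis using gen[of x y] by (simp add: F_def)
qed

text \<open>Schoenberg's characterization of inner product spaces, in one plane; \<open>k\<close> is
  the inner product of \<open>v\<close> and \<open>w\<close>. If a nontrivial combination has
  seminorm zero, then \<open>v\<close> and \<open>w\<close> agree up to sign modulo null vectors.
  Otherwise the plane contains a unit vector perpendicular to \<open>v\<close>, and
  \<open>euclidean_basis\<close> applies.\<close>

theorem quadratic:
  assumes v: "N v = 1" and w: "N w = 1"
  shows "\<exists>k. \<forall>x y. (N (x *\<^sub>R v + y *\<^sub>R w))\<^sup>2 = x\<^sup>2 + y\<^sup>2 + 2 * k * x * y"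
proof (cases "\<exists>x y. (x \<noteq> 0 \<or> y \<noteq> 0) \<and> N (x *\<^sub>R v + y *\<^sub>R w) = 0")
  case True
  then obtain x0 y0 where xy: "x0 \<noteq> 0 \<or> y0 \<noteq> 0" and N0: "N (x0 *\<^sub>R v + y0 *\<^sub>R w) = 0" by blast
  have "\<bar>N (x0 *\<^sub>R v) - N (- (y0 *\<^sub>R w))\<bar> \<le> N (x0 *\<^sub>R v - - (y0 *\<^sub>R w))" by (rule diff_bound)
  then have "\<bar>x0\<bar> = \<bar>y0\<bar>" using N0 by (simp add: scale v w)
  then obtain k where k: "k = 1 \<or> k = -1" "x0 = - k * y0" "y0 \<noteq> 0" using xy
    by (metis abs_eq_iff mult_1 mult_minus1 minus_minus abs_zero abs_eq_0)
  have kk: "N (w - k *\<^sub>R v) = 0"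
  proof -
    have "x0 *\<^sub>R v + y0 *\<^sub>R w = y0 *\<^sub>R (w - k *\<^sub>R v)" using k(2) by (simp add: algebra_simps)
    then show ?thesis using N0 k(3) by (simp add: scale)
  qed
  have "(N (x *\<^sub>R v + y *\<^sub>R w))\<^sup>2 = x\<^sup>2 + y\<^sup>2 + 2 * k * x * y" for x y
  proof -
    have "\<bar>N (x *\<^sub>R v + y *\<^sub>R w) - N ((x + k * y) *\<^sub>R v)\<bar> \<le> N (y *\<^sub>R (w - k *\<^sub>R v))"
      using diff_bound[of "x *\<^sub>R v + y *\<^sub>R w" "(x + k * y) *\<^sub>R v"] by (simp add: algebra_simps)
    then have "N (x *\<^sub>R v + y *\<^sub>R w) = \<bar>x + k * y\<bar>" by (simp add: scale kk v)
    moreover have "k * k = 1" using k(1) by auto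
    then have "(x + k * y)\<^sup>2 = x\<^sup>2 + y\<^sup>2 + 2 * k * x * y"
      using k(1) by (auto simp: power2_eq_square algebra_simps)
    ultimately show ?thesis by simp
  qed
  then show ?thesis by blast
next
  case False
  then have pos: "0 < N (x *\<^sub>R v + y *\<^sub>R w)" if "x \<noteq> 0 \<or> y \<noteq> 0" for x y
    using that nonneg[of "x *\<^sub>R v + y *\<^sub>R w"] by (metis antisym_conv1)
  have posc: "0 < N (cos t *\<^sub>R v + sin t *\<^sub>R w)" for t
    using pos[of "cos t" "sin t"] sin_cos_squared_add[of t] by fastforce
  define n where "n t = N (cos t *\<^sub>R v + sin t *\<^sub>R w)" for t
  \<comment> \<open>\<open>g\<close> compares the diagonals \<open>v + u\<close> and
    \<open>v - u\<close> for the unit vector \<open>u\<close> at angle \<open>t\<close>. It has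
    opposite signs at \<open>0\<close> and \<open>pi\<close>, so it vanishes at some angle.\<close>
  define g where "g t = N ((1 + cos t / n t) *\<^sub>R v + (sin t / n t) *\<^sub>R w) - N ((1 - cos t / n t) *\<^sub>R v + (- sin t / n t) *\<^sub>R w)" for t
  have comp: "continuous_on UNIV (\<lambda>t. N (x t *\<^sub>R v + y t *\<^sub>R w))"
    if "continuous_on UNIV x" "continuous_on UNIV y" for x y :: "real \<Rightarrow> real"
    using continuous_on_compose2[OF continuous_plane continuous_on_Pair[OF that]] by auto
  have contn: "continuous_on UNIV n" unfolding n_def by (intro comp continuous_intros)
  have n_pos: "n t > 0" for t using posc by (simp add: n_def)
  then have n_ne: "n t \<noteq> 0" for t by (metis less_irrefl)
  have contg: "continuous_on UNIV g" unfolding g_def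
    by (intro continuous_on_diff comp continuous_intros contn) (auto simp: n_ne)
  have n1: "n 0 = 1" "n pi = 1" by (simp_all add: n_def v)
  have gs: "g 0 = 2" "g pi = -2" using scale[of 2 v] by (simp_all add: g_def n1 v)
  have "\<exists>t. 0 \<le> t \<and> t \<le> pi \<and> g t = 0"
    by (rule IVT2') (auto simp: gs intro: continuous_on_subset[OF contg])
  then obtain t where t: "g t = 0" by blast
  define f where "f = (cos t / n t) *\<^sub>R v + (sin t / n t) *\<^sub>R w"
  have Nf: "N f = 1"
  proof -
    have "f = (1 / n t) *\<^sub>R (cos t *\<^sub>R v + sin t *\<^sub>R w)" by (simp add: f_def scaleR_add_right)
    then have "N f = \<bar>1 / n t\<bar> * n t" by (simp only: scale n_def)
    then show ?thesis using n_pos[of t] by simp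
  qed
  have vf: "N (v + f) = N (v - f)"
    using t by (simp add: g_def f_def algebra_simps)
  have sq: "(N (x *\<^sub>R v + y *\<^sub>R f))\<^sup>2 = x\<^sup>2 + y\<^sup>2" for x y
    by (rule euclidean_basis[OF v Nf vf])
  \<comment> \<open>Otherwise \<open>f\<close> would be a multiple of \<open>v\<close>, against
    \<open>sq\<close>. Hence \<open>w\<close> can be expressed by \<open>v\<close> and
    \<open>f\<close>.\<close>
  have "sin t \<noteq> 0"
  proof
    assume s: "sin t = 0"
    define b where "b = cos t / n t"
    have "f = b *\<^sub>R v" by (simp add: f_def s b_def)
    then have "N ((- b) *\<^sub>R v + 1 *\<^sub>R f) = 0" by simp
    then show False using sq[of "- b" 1] by (simp add: add_nonneg_eq_0_iff)
  qed
  define q where "q = n t / sin t"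
  define b where "b = cos t / sin t"
  have wv: "w = q *\<^sub>R f - b *\<^sub>R v"
    using \<open>sin t \<noteq> 0\<close> n_ne[of t] by (simp add: f_def q_def b_def scaleR_add_right)
  have "b\<^sup>2 + q\<^sup>2 = 1" using sq[of "- b" q] w wv by simp
  then have "(N (x *\<^sub>R v + y *\<^sub>R w))\<^sup>2 = x\<^sup>2 + y\<^sup>2 + 2 * (- b) * x * y" for x y
  proof -
    assume *: "b\<^sup>2 + q\<^sup>2 = 1"
    have "x *\<^sub>R v + y *\<^sub>R w = (x - y * b) *\<^sub>R v + (y * q) *\<^sub>R f" by (simp add: wv algebra_simps)
    then have "(N (x *\<^sub>R v + y *\<^sub>R w))\<^sup>2 = (x - y * b)\<^sup>2 + (y * q)\<^sup>2" by (simp add: sq)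
    also have "\<dots> = x\<^sup>2 + y\<^sup>2 * (b\<^sup>2 + q\<^sup>2) + 2 * (- b) * x * y"
      by (simp add: power2_eq_square algebra_simps)
    finally show ?thesis using * by simp
  qed
  then show ?thesis by blast
qed

end

section \<open>Stewart's inequality and \<open>CAT(0)\<close> spaces\<close>

text \<open>A relation, because geodesics are not unique in general. In a geodesic space every such
  point lies on some geodesic from \<open>x\<close> to \<open>y\<close>, by
  \<open>geodesic_path_through\<close>.\<close>

definition point_at :: "'a::metric_space set \<Rightarrow> 'a \<Rightarrow> 'a \<Rightarrow> real \<Rightarrow> 'a \<Rightarrow> bool" where
  "point_at X x y l m \<longleftrightarrow> m \<in> X \<and> dist x m = l * dist x y \<and> dist m y = (1 - l) * dist x y"

text \<open>For \<open>l = 1/2\<close> this is the CN inequality of Bruhat and Tits.\<close>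

definition stewart :: "'a::metric_space set \<Rightarrow> bool" where
  "stewart X \<longleftrightarrow> (\<forall>x\<in>X. \<forall>y\<in>X. \<forall>z\<in>X. \<forall>l\<in>{0..1}. \<forall>m. point_at X y z l m \<longrightarrow>
     (dist x m)\<^sup>2 \<le> (1 - l) * (dist x y)\<^sup>2 + l * (dist x z)\<^sup>2 - l * (1 - l) * (dist y z)\<^sup>2)"

lemma stewartD:
  assumes "stewart X" "x \<in> X" "y \<in> X" "z \<in> X" "0 \<le> l" "l \<le> 1" "point_at X y z l m"
  shows "(dist x m)\<^sup>2 \<le> (1 - l) * (dist x y)\<^sup>2 + l * (dist x z)\<^sup>2 - l * (1 - l) * (dist y z)\<^sup>2"
  using assms by (auto simp: stewart_def)

lemma point_at_sym: "point_at X x y l m \<Longrightarrow> point_at X y x (1 - l) m"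
  by (auto simp: point_at_def dist_commute)

text \<open>Stewart's theorem: the Euclidean equality against which \<open>stewart\<close>
  compares.\<close>

lemma dist_affine_combination:
  fixes x y z :: "'b::real_inner"
  shows "(dist x ((1 - l) *\<^sub>R y + l *\<^sub>R z))\<^sup>2
    = (1 - l) * (dist x y)\<^sup>2 + l * (dist x z)\<^sup>2 - l * (1 - l) * (dist y z)\<^sup>2"
proof -
  define a b where "a = x - y" and "b = z - y"
  have 1: "x - ((1 - l) *\<^sub>R y + l *\<^sub>R z) = a - l *\<^sub>R b" "x - z = a - b" "y - z = - b"
    by (simp_all add: a_def b_def algebra_simps)
  have "(norm (a - l *\<^sub>R b))\<^sup>2 = (1 - l) * (norm a)\<^sup>2 + l * (norm (a - b))\<^sup>2 - l * (1 - l) * (norm b)\<^sup>2"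
    unfolding power2_norm_eq_inner inner_diff_left inner_diff_right inner_scaleR_left inner_scaleR_right
      inner_commute[of b a]
    by algebra
  then show ?thesis
    unfolding dist_norm 1 norm_minus_cancel by (simp add: a_def)
qed

section \<open>Geodesic paths and the points on them\<close>

lemma geodesic_pathD:
  assumes "geodesic_path X x y \<gamma>"
  shows "\<And>s. 0 \<le> s \<Longrightarrow> s \<le> dist x y \<Longrightarrow> \<gamma> s \<in> X"
    and "\<And>s t. 0 \<le> s \<Longrightarrow> s \<le> dist x y \<Longrightarrow> 0 \<le> t \<Longrightarrow> t \<le> dist x y \<Longrightarrow> dist (\<gamma> s) (\<gamma> t) = \<bar>s - t\<bar>"
    and "\<gamma> 0 = x" "\<gamma> (dist x y) = y"
  using assms by (auto simp: geodesic_path_def)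

lemma geodesic_path_point_at:
  assumes "geodesic_path X x y \<gamma>" "0 \<le> l" "l \<le> 1"
  shows "point_at X x y l (\<gamma> (l * dist x y))"
proof -
  note g = geodesic_pathD[OF assms(1)]
  have l: "0 \<le> l * dist x y" "l * dist x y \<le> dist x y"
    using assms by (simp_all add: mult_left_le_one_le)
  have "dist (\<gamma> 0) (\<gamma> (l * dist x y)) = \<bar>0 - l * dist x y\<bar>"
    "dist (\<gamma> (l * dist x y)) (\<gamma> (dist x y)) = \<bar>l * dist x y - dist x y\<bar>"
    by (rule g(2); use l in simp)+
  then show ?thesis
    using l g(1)[OF l] g(3,4) by (simp add: point_at_def algebra_simps)
qed

lemma point_at_exists:
  assumes "geodesic_space X" "x \<in> X" "y \<in> X" "0 \<le> l" "l \<le> 1"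
  obtains m where "point_at X x y l m"
  using assms geodesic_path_point_at unfolding geodesic_space_def by blast

text \<open>For points on different pieces, the path through \<open>m\<close> bounds their distance
  from above; from below it is bounded by the triangle inequality for \<open>x\<close> and
  \<open>y\<close>, as any shortcut would bring the endpoints closer together.\<close>

lemma geodesic_path_concat:
  assumes 1: "geodesic_path X x m \<gamma>1" and 2: "geodesic_path X m y \<gamma>2"
    and add: "dist x m + dist m y = dist x y"
  shows "\<exists>\<gamma>. geodesic_path X x y \<gamma> \<and> \<gamma> (dist x m) = m"
proof -
  note g1 = geodesic_pathD[OF 1] and g2 = geodesic_pathD[OF 2]
  define d where "d = dist x m"
  define \<gamma> where "\<gamma> s = (if s \<le> d then \<gamma>1 s else \<gamma>2 (s - d))" for s
  have in_X: "\<gamma> s \<in> X" if "0 \<le> s" "s \<le> dist x y" for s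
    using that g1(1)[of s] g2(1)[of "s - d"] add by (auto simp: \<gamma>_def d_def)
  have gx: "dist x (\<gamma> s) = s" if "0 \<le> s" "s \<le> d" for s
    using g1(2)[of 0 s] g1(3) that by (simp add: \<gamma>_def d_def)
  have gy: "dist (\<gamma> s) y = dist x y - s" if "d < s" "s \<le> dist x y" for s
    using g2(2)[of "s - d" "dist m y"] g2(4) that add by (simp add: \<gamma>_def d_def)
  have mix: "dist (\<gamma> s) (\<gamma> t) = t - s" if "0 \<le> s" "s \<le> d" "d < t" "t \<le> dist x y" for s t
  proof (rule antisym)
    have "dist (\<gamma> s) m = d - s"
      using g1(2)[of s "dist x m"] g1(4) that by (simp add: \<gamma>_def d_def)
    moreover have "dist m (\<gamma> t) = t - d"
      using g2(2)[of 0 "t - d"] g2(3) that add by (simp add: \<gamma>_def d_def)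
    ultimately show "dist (\<gamma> s) (\<gamma> t) \<le> t - s"
      using dist_triangle[of "\<gamma> s" "\<gamma> t" m] by simp
    show "t - s \<le> dist (\<gamma> s) (\<gamma> t)"
      using gx[of s] gy[of t] that dist_triangle[of x y "\<gamma> s"] dist_triangle[of "\<gamma> s" y "\<gamma> t"] by simp
  qed
  have "dist (\<gamma> s) (\<gamma> t) = \<bar>s - t\<bar>" if "0 \<le> s" "s \<le> dist x y" "0 \<le> t" "t \<le> dist x y" for s t
  proof (cases "s \<le> d"; cases "t \<le> d")
    assume "s \<le> d" "t \<le> d"
    then show ?thesis using g1(2)[of s t] that by (simp add: \<gamma>_def d_def)
  next
    assume "\<not> s \<le> d" "\<not> t \<le> d"
    then show ?thesis using g2(2)[of "s - d" "t - d"] that add by (simp add: \<gamma>_def d_def)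
  next
    assume "s \<le> d" "\<not> t \<le> d"
    then show ?thesis using mix[of s t] that by simp
  next
    assume "\<not> s \<le> d" "t \<le> d"
    then show ?thesis using mix[of t s] that by (simp add: dist_commute)
  qed
  moreover have "\<gamma> 0 = x" using g1(3) by (simp add: \<gamma>_def d_def)
  moreover have "\<gamma> d = m" using g1(4) by (simp add: \<gamma>_def d_def)
  moreover have "\<gamma> (dist x y) = y"
    using g2(4) g1(4) unfolding \<gamma>_def d_def add[symmetric] by (cases "m = y") auto
  ultimately show ?thesis
    using in_X by (intro exI[of _ \<gamma>]) (auto simp: geodesic_path_def d_def)
qed

lemma geodesic_path_through:
  assumes "geodesic_space X" "x \<in> X" "y \<in> X" "point_at X x y l m"
  obtains \<gamma> where "geodesic_path X x y \<gamma>" "\<gamma> (l * dist x y) = m"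
proof -
  have m: "m \<in> X" "dist x m = l * dist x y" "dist m y = (1 - l) * dist x y"
    using assms(4) by (auto simp: point_at_def)
  obtain \<gamma>1 \<gamma>2 where "geodesic_path X x m \<gamma>1" "geodesic_path X m y \<gamma>2"
    using assms(1-3) m(1) unfolding geodesic_space_def by blast
  then obtain \<gamma> where "geodesic_path X x y \<gamma> \<and> \<gamma> (dist x m) = m"
    using geodesic_path_concat[of X x m \<gamma>1 y \<gamma>2] m by (auto simp: algebra_simps)
  then show ?thesis using that m(2) by auto
qed

section \<open>CAT(0) spaces satisfy Stewart's inequality\<close>

lemma CAT0_spaceD:
  assumes "CAT0_space X" "geodesic_triangle X v S" "comparison_triangle v w"
    and "p \<in> S i" "q \<in> S j" "comparison_point v w i p p'" "comparison_point v w j q q'"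
  shows "dist p q \<le> dist p' q'"
  by (rule conjunct2[OF assms(1)[unfolded CAT0_space_def], rule_format, OF assms(2-7)])

text \<open>Two vertices are put on the first axis; the law of cosines gives the first coordinate of
  the third, and Heron's factorization shows that the second one exists.\<close>

lemma planar_triangle_exists:
  fixes a b c :: real
  assumes "0 \<le> a" "0 \<le> b" "0 \<le> c" "a \<le> b + c" "b \<le> a + c" "c \<le> a + b"
  shows "\<exists>x y z :: real ^ 2. dist x y = a \<and> dist x z = b \<and> dist y z = c"
proof -
  have d: "dist (vector [p, q] :: real ^ 2) (vector [r, s]) = sqrt ((p - r)\<^sup>2 + (q - s)\<^sup>2)" for p q r s :: real
    by (simp add: dist_vec_def L2_set_def sum_2 dist_real_def)
  \<comment> \<open>If \<open>a = 0\<close>, then \<open>b = c\<close> and the third vertex may be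
    put on the axis as well.\<close>
  define u where "u = (if a = 0 then b else (a\<^sup>2 + b\<^sup>2 - c\<^sup>2) / (2 * a))"
  have au: "2 * a * u = a\<^sup>2 + b\<^sup>2 - c\<^sup>2" using assms by (auto simp: u_def)
  have "u\<^sup>2 \<le> b\<^sup>2"
  proof (cases "a = 0")
    case False
    then have a: "a > 0" using assms by simp
    \<comment> \<open>Heron's formula: both sides are 16 times the squared area.\<close>
    have "(2 * a * b)\<^sup>2 - (2 * a * u)\<^sup>2 = ((a + b) + c) * ((a + b) - c) * ((c - (a - b)) * (c + (a - b)))"
      unfolding au by (simp add: power2_eq_square algebra_simps)
    also have "\<dots> \<ge> 0" using assms by (intro mult_nonneg_nonneg) auto
    finally have "(2 * a)\<^sup>2 * u\<^sup>2 \<le> (2 * a)\<^sup>2 * b\<^sup>2" by (simp add: power_mult_distrib algebra_simps)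
    then show ?thesis using a by simp
  qed (simp add: u_def)
  then have v: "u\<^sup>2 + (sqrt (b\<^sup>2 - u\<^sup>2))\<^sup>2 = b\<^sup>2" by simp
  have "dist (vector [0, 0] :: real ^ 2) (vector [a, 0]) = a" using assms by (simp add: d)
  moreover have "dist (vector [0, 0] :: real ^ 2) (vector [u, sqrt (b\<^sup>2 - u\<^sup>2)]) = b"
    using assms v by (simp add: d)
  moreover have "(a - u)\<^sup>2 + (0 - sqrt (b\<^sup>2 - u\<^sup>2))\<^sup>2 = c\<^sup>2"
    using au v by (simp add: power2_diff)
  then have "dist (vector [a, 0] :: real ^ 2) (vector [u, sqrt (b\<^sup>2 - u\<^sup>2)]) = c"
    unfolding d using assms by simp
  ultimately show ?thesis by blast
qed

lemma CAT0_space_imp_stewart: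
  assumes cat: "CAT0_space X"
  shows "stewart X"
  unfolding stewart_def
proof (intro ballI allI impI)
  fix x y z l m
  assume X: "x \<in> X" "y \<in> X" "z \<in> X" and l: "l \<in> {0..1::real}" and m: "point_at X y z l m"
  have geo: "geodesic_space X" using cat by (simp add: CAT0_space_def)
  \<comment> \<open>The vertices are numbered so that \<open>m\<close> lies on side 1, from
    \<open>y\<close> to \<open>z\<close>; \<open>x\<close> is vertex 3, where side 3 begins.\<close>
  define v :: "3 \<Rightarrow> 'a" where "v i = (if i = 1 then y else if i = 2 then z else x)" for i
  have vX: "v i \<in> X" for i using X by (simp add: v_def)
  obtain \<gamma> where \<gamma>: "geodesic_path X y z \<gamma>" "\<gamma> (l * dist y z) = m"
    using geodesic_path_through[OF geo X(2,3) m] .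
  have "\<exists>S. geodesic_segment X (v i) (v (i + 1)) S" for i
    using geo vX unfolding geodesic_segment_def geodesic_space_def by blast
  then obtain S0 where S0: "\<And>i. geodesic_segment X (v i) (v (i + 1)) (S0 i)" by metis
  \<comment> \<open>Side 1 has to be a geodesic through \<open>m\<close>; the other sides are
    arbitrary.\<close>
  define S where "S i = (if i = 1 then \<gamma> ` {0..dist y z} else S0 i)" for i
  have tri: "geodesic_triangle X v S"
    unfolding geodesic_triangle_def
  proof (intro conjI allI)
    fix i :: 3
    show "geodesic_segment X (v i) (v (i + 1)) (S i)"
    proof (cases "i = 1")
      case True
      then show ?thesis using \<gamma>(1) by (auto simp: S_def v_def geodesic_segment_def)
    qed (simp add: S_def S0)
  qed (rule vX)
  obtain w1 w2 w3 :: "real ^ 2" where w: "dist w1 w2 = dist y z" "dist w1 w3 = dist y x" "dist w2 w3 = dist z x"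
    using planar_triangle_exists[of "dist y z" "dist y x" "dist z x"]
      dist_triangle[of y z x] dist_triangle[of y x z] dist_triangle[of z x y]
    by (auto simp: dist_commute)
  define w where "w i = (if i = 1 then w1 else if i = 2 then w2 else w3)" for i :: 3
  have comp: "comparison_triangle v w"
    using w by (auto simp: comparison_triangle_def forall_3 v_def w_def dist_commute)
  define m' where "m' = (1 - l) *\<^sub>R w1 + l *\<^sub>R w2"
  have "m \<in> S 1"
    unfolding S_def using \<gamma>(2) l by (auto intro!: image_eqI[of _ _ "l * dist y z"] mult_left_le_one_le)
  moreover have "x \<in> S 3"
  proof -
    obtain g where "geodesic_path X (v 3) (v (3 + 1)) g" "S 3 = g ` {0..dist (v 3) (v (3 + 1))}"
      using S0[of 3] by (auto simp: S_def geodesic_segment_def)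
    then show ?thesis using geodesic_pathD(3)[of X "v 3" "v (3 + 1)" g]
      by (auto intro!: image_eqI[of _ _ 0] simp: v_def)
  qed
  moreover have "comparison_point v w 1 m m'"
  proof -
    have "w1 - m' = l *\<^sub>R (w1 - w2)" by (simp add: m'_def algebra_simps)
    then have "dist w1 m' = l * dist w1 w2" using l by (simp add: dist_norm)
    then have "dist w1 m' = dist y m" using m w(1) by (simp add: point_at_def)
    moreover have "m' \<in> closed_segment w1 w2" using l by (auto simp: m'_def in_segment)
    ultimately show ?thesis by (simp add: comparison_point_def w_def v_def)
  qed
  moreover have "comparison_point v w 3 x w3"
    by (simp add: comparison_point_def w_def v_def)
  ultimately have "dist m x \<le> dist m' w3"
    by (rule CAT0_spaceD[OF cat tri comp])
  then have "dist x m \<le> dist w3 m'" by (simp add: dist_commute)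
  then have "(dist x m)\<^sup>2 \<le> (dist w3 m')\<^sup>2" by (rule power_mono) simp
  also have "\<dots> = (1 - l) * (dist x y)\<^sup>2 + l * (dist x z)\<^sup>2 - l * (1 - l) * (dist y z)\<^sup>2"
    unfolding m'_def dist_affine_combination using w by (simp add: dist_commute)
  finally show "(dist x m)\<^sup>2 \<le> (1 - l) * (dist x y)\<^sup>2 + l * (dist x z)\<^sup>2 - l * (1 - l) * (dist y z)\<^sup>2" .
qed

section \<open>Stewart's inequality implies the CAT(0) comparison\<close>

text \<open>Stewart's inequality is applied first to \<open>C\<close> and the side from
  \<open>A\<close> to \<open>B\<close>, then to \<open>P\<close> and the side from \<open>B\<close>
  to \<open>C\<close>. Both are equalities for the primed points.\<close>

lemma stewart_hinge:
  fixes A' B' C' :: "'b::real_inner"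
  assumes st: "stewart X" and X: "A \<in> X" "B \<in> X" "C \<in> X"
    and s: "0 \<le> s" "s \<le> 1" and t: "0 \<le> t" "t \<le> 1"
    and P: "point_at X A B s P" and Q: "point_at X B C t Q"
    and d: "dist A' B' = dist A B" "dist B' C' = dist B C" "dist A' C' = dist A C"
  shows "dist P Q \<le> dist ((1 - s) *\<^sub>R A' + s *\<^sub>R B') ((1 - t) *\<^sub>R B' + t *\<^sub>R C')"
proof -
  define P' where "P' = (1 - s) *\<^sub>R A' + s *\<^sub>R B'"
  define Q' where "Q' = (1 - t) *\<^sub>R B' + t *\<^sub>R C'"
  have PX: "P \<in> X" using P by (simp add: point_at_def)
  have d': "dist C' A' = dist C A" "dist C' B' = dist C B"
    using d by (metis dist_commute)+
  have "(dist C P)\<^sup>2 \<le> (dist C' P')\<^sup>2"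
    using stewartD[OF st X(3) X(1,2) s P] unfolding P'_def dist_affine_combination d' d(1) .
  then have C: "(dist P C)\<^sup>2 \<le> (dist P' C')\<^sup>2" by (simp add: dist_commute)
  have "P' - B' = (1 - s) *\<^sub>R (A' - B')" by (simp add: P'_def algebra_simps)
  then have "dist P' B' = (1 - s) * dist A' B'"
    using s(2) by (simp add: dist_norm)
  then have B: "dist P' B' = dist P B"
    using P by (simp add: d(1) point_at_def)
  have "(dist P Q)\<^sup>2 \<le> (1 - t) * (dist P B)\<^sup>2 + t * (dist P C)\<^sup>2 - t * (1 - t) * (dist B C)\<^sup>2"
    by (rule stewartD[OF st PX X(2,3) t Q])
  also have "\<dots> \<le> (1 - t) * (dist P' B')\<^sup>2 + t * (dist P' C')\<^sup>2 - t * (1 - t) * (dist B' C')\<^sup>2"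
    using mult_left_mono[OF C t(1)] unfolding B d(2) by linarith
  also have "\<dots> = (dist P' Q')\<^sup>2"
    unfolding Q'_def dist_affine_combination ..
  finally show ?thesis unfolding P'_def[symmetric] Q'_def[symmetric]
    by (rule power2_le_imp_le) simp
qed

text \<open>The fraction \<open>u\<close> is read off from \<open>p'\<close>, which also covers
  sides of length zero; \<open>p\<close> has the same fraction because its distance from the vertex
  is the same.\<close>

lemma comparison_pointE:
  assumes tri: "geodesic_triangle X v S" and comp: "comparison_triangle v w"
    and p: "p \<in> S i" "comparison_point v w i p p'"
  obtains u where "0 \<le> u" "u \<le> 1" "p' = (1 - u) *\<^sub>R w i + u *\<^sub>R w (i + 1)" "point_at X (v i) (v (i + 1)) u p"
proof -
  obtain \<gamma> where \<gamma>: "geodesic_path X (v i) (v (i + 1)) \<gamma>" "S i = \<gamma> ` {0..dist (v i) (v (i + 1))}"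
    using tri unfolding geodesic_triangle_def geodesic_segment_def by blast
  obtain a where a: "0 \<le> a" "a \<le> dist (v i) (v (i + 1))" "p = \<gamma> a"
    using p(1) \<gamma>(2) by auto
  obtain u where u: "0 \<le> u" "u \<le> 1" "p' = (1 - u) *\<^sub>R w i + u *\<^sub>R w (i + 1)"
    using p(2) by (auto simp: comparison_point_def in_segment)
  have "w i - p' = u *\<^sub>R (w i - w (i + 1))" by (simp add: u(3) algebra_simps)
  then have "dist (w i) p' = u * dist (w i) (w (i + 1))"
    using u(1) by (simp add: dist_norm)
  then have "dist (w i) p' = u * dist (v i) (v (i + 1))"
    using comp by (simp add: comparison_triangle_def)
  moreover have "dist (v i) p = a"
    using geodesic_pathD(2)[OF \<gamma>(1), of 0 a] geodesic_pathD(3)[OF \<gamma>(1)] a by simp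
  ultimately have "a = u * dist (v i) (v (i + 1))"
    using p(2) by (simp add: comparison_point_def)
  then have "point_at X (v i) (v (i + 1)) u p"
    using geodesic_path_point_at[OF \<gamma>(1) u(1,2)] a(3) by simp
  then show ?thesis using that u by blast
qed

text \<open>Two sides either coincide or follow one another cyclically. On one side, distances are
  differences of distances from the vertex; for consecutive sides \<open>stewart_hinge\<close>
  applies.\<close>

lemma stewart_imp_CAT0_space:
  assumes geo: "geodesic_space X" and st: "stewart X"
  shows "CAT0_space X"
  unfolding CAT0_space_def
proof (intro conjI geo allI impI ballI)
  fix v :: "3 \<Rightarrow> 'a" and S w i j p q p' q'
  assume tri: "geodesic_triangle X v S" and comp: "comparison_triangle v w"
    and p: "p \<in> S i" and q: "q \<in> S j"
    and p': "comparison_point v w i p p'" and q': "comparison_point v w j q q'"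
  have vX: "v i \<in> X" for i using tri by (simp add: geodesic_triangle_def)
  have d: "dist (w i) (w j) = dist (v i) (v j)" for i j using comp by (simp add: comparison_triangle_def)
  have adjacent: "dist p q \<le> dist p' q'"
    if pq: "p \<in> S i" "q \<in> S (i + 1)" "comparison_point v w i p p'" "comparison_point v w (i + 1) q q'"
    for i p q p' q'
  proof -
    obtain s where s: "0 \<le> s" "s \<le> 1" "p' = (1 - s) *\<^sub>R w i + s *\<^sub>R w (i + 1)" "point_at X (v i) (v (i + 1)) s p"
      using comparison_pointE[OF tri comp pq(1,3)] .
    obtain t where t: "0 \<le> t" "t \<le> 1" "q' = (1 - t) *\<^sub>R w (i + 1) + t *\<^sub>R w (i + 1 + 1)"
      "point_at X (v (i + 1)) (v (i + 1 + 1)) t q"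
      using comparison_pointE[OF tri comp pq(2,4)] .
    show ?thesis unfolding s(3) t(3)
      by (rule stewart_hinge[OF st vX vX vX s(1,2) t(1,2) s(4) t(4) d d d])
  qed
  have "j = i \<or> j = i + 1 \<or> i = j + 1"
  proof -
    have "\<forall>i j :: 3. j = i \<or> j = i + 1 \<or> i = j + 1" by (simp add: forall_3)
    then show ?thesis by blast
  qed
  then show "dist p q \<le> dist p' q'"
  proof (elim disjE)
    assume [simp]: "j = i"
    obtain \<gamma> where \<gamma>: "geodesic_path X (v i) (v (i + 1)) \<gamma>" "S i = \<gamma> ` {0..dist (v i) (v (i + 1))}"
      using tri unfolding geodesic_triangle_def geodesic_segment_def by blast
    obtain a b where ab: "0 \<le> a" "a \<le> dist (v i) (v (i + 1))" "p = \<gamma> a"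
      "0 \<le> b" "b \<le> dist (v i) (v (i + 1))" "q = \<gamma> b"
      using p q \<gamma>(2) by auto
    note g = geodesic_pathD[OF \<gamma>(1)]
    have "dist (v i) p = a" "dist (v i) q = b" "dist p q = \<bar>a - b\<bar>"
      using g(2)[of 0 a] g(2)[of 0 b] g(2)[of a b] g(3) ab by simp_all
    then have "dist p q = \<bar>dist (w i) p' - dist (w i) q'\<bar>"
      using p' q' by (simp add: comparison_point_def)
    then show ?thesis
      using dist_triangle[of "w i" p' q'] dist_triangle[of "w i" q' p'] by (simp add: dist_commute)
  next
    assume "j = i + 1"
    then show ?thesis using adjacent p q p' q' by simp
  next
    assume "i = j + 1"
    then show ?thesis using adjacent[of q j p q' p'] p q p' q' by (simp add: dist_commute)
  qed
qed

section \<open>Stewart's inequality implies Busemann convexity\<close>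

text \<open>Two applications of Stewart's inequality, to \<open>z\<close> and the side from
  \<open>x\<close> to \<open>y\<close> and to \<open>p\<close> and the side from \<open>x\<close> to
  \<open>z\<close>; all terms except that of \<open>dist y z\<close> cancel.\<close>

lemma stewart_similar:
  assumes st: "stewart X" and X: "x \<in> X" "y \<in> X" "z \<in> X" and l: "0 \<le> l" "l \<le> 1"
    and p: "point_at X x y l p" and q: "point_at X x z l q"
  shows "dist p q \<le> l * dist y z"
proof -
  have pX: "p \<in> X" and p': "dist p x = l * dist x y"
    using p by (simp_all add: point_at_def dist_commute)
  have z: "(dist p z)\<^sup>2 \<le> (1 - l) * (dist x z)\<^sup>2 + l * (dist y z)\<^sup>2 - l * (1 - l) * (dist x y)\<^sup>2"
    using stewartD[OF st X(3,1,2) l p] by (simp add: dist_commute)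
  have "(dist p q)\<^sup>2 \<le> (1 - l) * (dist p x)\<^sup>2 + l * (dist p z)\<^sup>2 - l * (1 - l) * (dist x z)\<^sup>2"
    by (rule stewartD[OF st pX X(1,3) l q])
  also have "\<dots> \<le> (1 - l) * (l * dist x y)\<^sup>2 + l * ((1 - l) * (dist x z)\<^sup>2 + l * (dist y z)\<^sup>2 - l * (1 - l) * (dist x y)\<^sup>2)
      - l * (1 - l) * (dist x z)\<^sup>2"
    using mult_left_mono[OF z l(1)] by (simp add: p')
  also have "\<dots> = (l * dist y z)\<^sup>2"
    by (simp add: power2_eq_square algebra_simps)
  finally show ?thesis by (rule power2_le_imp_le) (simp add: l)
qed

lemma stewart_imp_busemann_convex:
  assumes geo: "geodesic_space X" and st: "stewart X"
  shows "busemann_convex X"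
  unfolding busemann_convex_def
proof (intro conjI geo allI impI)
  fix I :: "real set" and \<alpha> \<beta> :: "real \<Rightarrow> 'a"
  assume I: "is_interval I" and \<alpha>: "affine_geodesic X I \<alpha>" and \<beta>: "affine_geodesic X I \<beta>"
  have conv: "convex I" using I by (simp add: is_interval_convex)
  have at: "point_at X (\<alpha> s) (\<alpha> t) l (\<alpha> ((1 - l) * s + l * t))"
    if "affine_geodesic X I \<alpha>" "s \<in> I" "t \<in> I" "0 \<le> l" "l \<le> 1" for \<alpha> s t l
  proof -
    obtain c where c: "c \<ge> 0" "\<And>s t. s \<in> I \<Longrightarrow> t \<in> I \<Longrightarrow> dist (\<alpha> s) (\<alpha> t) = c * \<bar>s - t\<bar>"
      using \<open>affine_geodesic X I \<alpha>\<close> unfolding affine_geodesic_def by blast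
    have u: "(1 - l) * s + l * t \<in> I"
      using conv that(2-5) convexD_alt[of I s t l] by simp
    have "s - ((1 - l) * s + l * t) = l * (s - t)" "(1 - l) * s + l * t - t = (1 - l) * (s - t)"
      by (simp_all add: algebra_simps)
    then show ?thesis
      using that u c by (auto simp: point_at_def affine_geodesic_def abs_mult)
  qed
  have inX: "\<alpha> t \<in> X" "\<beta> t \<in> X" if "t \<in> I" for t
    using \<alpha> \<beta> that by (auto simp: affine_geodesic_def)
  show "convex_on I (\<lambda>t. dist (\<alpha> t) (\<beta> t))"
  proof (rule convex_onI[OF _ conv])
    fix l s t :: real assume l: "0 < l" "l < 1" and st': "s \<in> I" "t \<in> I"
    \<comment> \<open>The diagonal from \<open>\<alpha> s\<close> to \<open>\<beta> t\<close> splits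
      the quadrilateral into two triangles, in each of which \<open>stewart_similar\<close>
      applies.\<close>
    obtain r where r: "point_at X (\<alpha> s) (\<beta> t) l r"
      using point_at_exists[OF geo inX(1)[OF st'(1)] inX(2)[OF st'(2)], of l] l by auto
    define p q where "p = \<alpha> ((1 - l) * s + l * t)" and "q = \<beta> ((1 - l) * s + l * t)"
    have "dist p r \<le> l * dist (\<alpha> t) (\<beta> t)"
      using stewart_similar[OF st inX(1)[OF st'(1)] inX(1)[OF st'(2)] inX(2)[OF st'(2)] _ _ at[OF \<alpha> st'] r] l
      by (simp add: p_def)
    moreover have "dist r q \<le> (1 - l) * dist (\<alpha> s) (\<beta> s)"
      using stewart_similar[OF st inX(2)[OF st'(2)] inX(1)[OF st'(1)] inX(2)[OF st'(1)] _ _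
          point_at_sym[OF r] point_at_sym[OF at[OF \<beta> st']]] l
      by (simp add: q_def)
    ultimately show "dist (\<alpha> ((1 - l) *\<^sub>R s + l *\<^sub>R t)) (\<beta> ((1 - l) *\<^sub>R s + l *\<^sub>R t))
        \<le> (1 - l) * dist (\<alpha> s) (\<beta> s) + l * dist (\<alpha> t) (\<beta> t)"
      using dist_triangle[of p q r] by (simp add: p_def q_def)
  qed
qed

section \<open>Stewart's inequality implies Ptolemy's\<close>

lemma stewart_imp_ptolemy:
  assumes geo: "geodesic_space X" and st: "stewart X"
  shows "ptolemy X"
  unfolding ptolemy_def
proof (intro ballI)
  fix x y u v assume X: "x \<in> X" "y \<in> X" "u \<in> X" "v \<in> X"
  define a b c d D E where defs: "a = dist x u" "b = dist y u" "c = dist y v" "d = dist x v" "D = dist x y" "E = dist u v"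
  show "dist x y * dist u v \<le> dist x u * dist y v + dist x v * dist y u"
  proof (cases "a = 0 \<or> b = 0 \<or> c = 0 \<or> d = 0")
    case True
    then show ?thesis by (auto simp: defs dist_commute)
  next
    case False
    then have pos: "a > 0" "b > 0" "c > 0" "d > 0" by (auto simp: defs)
    \<comment> \<open>In a cyclic quadrilateral with consecutive sides \<open>a\<close>,
      \<open>b\<close>, \<open>c\<close>, \<open>d\<close>, the diagonals meet at the fractions
      \<open>t\<close> and \<open>s\<close> defined from these sums, by comparing areas of
      triangles.\<close>
    define g h where "g = a * d + b * c" and "h = a * b + c * d"
    have gh: "g > 0" "h > 0" using pos by (simp_all add: g_def h_def add_pos_pos)
    define t s where "t = a * d / g" and "s = a * b / h"
    have t: "0 \<le> t" "t \<le> 1" "1 - t = b * c / g" and s: "0 \<le> s" "s \<le> 1" "1 - s = c * d / h"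
      using pos gh by (simp_all add: t_def s_def field_simps) (simp_all add: g_def h_def)
    obtain m where m: "point_at X x y t m" using point_at_exists[OF geo X(1,2) t(1,2)] .
    obtain n where n: "point_at X u v s n" using point_at_exists[OF geo X(3,4) s(1,2)] .
    have mX: "m \<in> X" using m by (simp add: point_at_def)
    have mu: "(dist m u)\<^sup>2 \<le> (1 - t) * a\<^sup>2 + t * b\<^sup>2 - t * (1 - t) * D\<^sup>2"
      using stewartD[OF st X(3,1,2) t(1,2) m] by (simp add: defs dist_commute)
    have mv: "(dist m v)\<^sup>2 \<le> (1 - t) * d\<^sup>2 + t * c\<^sup>2 - t * (1 - t) * D\<^sup>2"
      using stewartD[OF st X(4,1,2) t(1,2) m] by (simp add: defs dist_commute)
    have "0 \<le> (dist m n)\<^sup>2" by simp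
    also have "\<dots> \<le> (1 - s) * (dist m u)\<^sup>2 + s * (dist m v)\<^sup>2 - s * (1 - s) * E\<^sup>2"
      using stewartD[OF st mX X(3,4) s(1,2) n] by (simp add: defs)
    also have "\<dots> \<le> (1 - s) * ((1 - t) * a\<^sup>2 + t * b\<^sup>2 - t * (1 - t) * D\<^sup>2)
        + s * ((1 - t) * d\<^sup>2 + t * c\<^sup>2 - t * (1 - t) * D\<^sup>2) - s * (1 - s) * E\<^sup>2"
      using mult_left_mono[OF mu, of "1 - s"] mult_left_mono[OF mv s(1)] s by simp
    also have "\<dots> = (1 - s) * (1 - t) * a\<^sup>2 + (1 - s) * t * b\<^sup>2 + s * (1 - t) * d\<^sup>2 + s * t * c\<^sup>2
        - t * (1 - t) * D\<^sup>2 - s * (1 - s) * E\<^sup>2"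
      by (simp add: algebra_simps)
    also have "\<dots> = a * b * c * d / (g * h) * (2 * (a * c + b * d)) - a * b * c * d * (D\<^sup>2 / g\<^sup>2) - a * b * c * d * (E\<^sup>2 / h\<^sup>2)"
      unfolding t(3) s(3) using gh by (simp add: t_def s_def field_simps power2_eq_square)
    also have "\<dots> = a * b * c * d / (g * h) * (2 * (a * c + b * d) - (D\<^sup>2 * (h / g) + E\<^sup>2 * (g / h)))"
      using gh by (simp add: field_simps power2_eq_square)
    finally have *: "0 \<le> a * b * c * d / (g * h) * (2 * (a * c + b * d) - (D\<^sup>2 * (h / g) + E\<^sup>2 * (g / h)))" .
    have "0 < a * b * c * d / (g * h)" using pos gh by simp
    then have "D\<^sup>2 * (h / g) + E\<^sup>2 * (g / h) \<le> 2 * (a * c + b * d)"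
      using * by (simp only: zero_le_mult_iff) linarith
    \<comment> \<open>Arithmetic and geometric mean, weighted so that equality holds if
      \<open>D / E = g / h\<close>, the ratio of the diagonals of a cyclic quadrilateral.\<close>
    moreover have "2 * (D * E) \<le> D\<^sup>2 * (h / g) + E\<^sup>2 * (g / h)"
    proof -
      have "0 \<le> (D * h - E * g)\<^sup>2 / (g * h)" using gh by simp
      also have "\<dots> = D\<^sup>2 * (h / g) + E\<^sup>2 * (g / h) - 2 * (D * E)"
        using gh by (simp add: field_simps power2_eq_square)
      finally show ?thesis by simp
    qed
    ultimately show ?thesis by (simp add: defs algebra_simps)
  qed
qed

section \<open>Strong convexity from a dense set of subgradients\<close>

text \<open>Near a negative value the function would stay negative. Points of \<open>D\<close> are
  taken to the right of \<open>t\<close>, whence \<open>t < b\<close>.\<close>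

lemma nonneg_by_density:
  fixes g :: "real \<Rightarrow> real"
  assumes cont: "continuous_on {a..b} g"
    and dense: "\<And>y z. a \<le> y \<Longrightarrow> y < z \<Longrightarrow> z \<le> b \<Longrightarrow> \<exists>d\<in>D. y < d \<and> d < z"
    and nonneg: "\<And>d. d \<in> D \<Longrightarrow> a \<le> d \<Longrightarrow> d \<le> b \<Longrightarrow> 0 \<le> g d"
    and t: "a \<le> t" "t < b"
  shows "0 \<le> g t"
proof (rule ccontr)
  assume "\<not> 0 \<le> g t"
  then have "0 < - g t" by simp
  have "\<exists>e>0. \<forall>y\<in>{a..b}. dist y t < e \<longrightarrow> dist (g y) (g t) < - g t"
    by (rule cont[unfolded continuous_on_iff, rule_format]) (use t \<open>0 < - g t\<close> in auto)
  then obtain e where e: "e > 0" "\<And>y. y \<in> {a..b} \<Longrightarrow> dist y t < e \<Longrightarrow> dist (g y) (g t) < - g t"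
    by blast
  obtain d where d: "d \<in> D" "t < d" "d < min b (t + e)"
    using dense[of t "min b (t + e)"] t e(1) by auto
  have "dist (g d) (g t) < - g t" using e(2)[of d] d t by (auto simp: dist_real_def)
  moreover have "0 \<le> g d" using nonneg[of d] d t by auto
  ultimately show False by (simp add: dist_real_def)
qed

text \<open>With \<open>n\<close> equal steps the errors add up to
  \<open>(b - a)\<^sup>2 / n\<close>, which tends to zero.\<close>

lemma nondecreasing_by_quadratic_error:
  fixes F :: "real \<Rightarrow> real"
  assumes step: "\<And>u x. a \<le> u \<Longrightarrow> u \<le> x \<Longrightarrow> x \<le> b \<Longrightarrow> F u - (x - u)\<^sup>2 \<le> F x" and ab: "a \<le> b"
  shows "F a \<le> F b"
proof (rule ccontr)
  assume less: "\<not> F a \<le> F b"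
  then obtain n :: nat where n: "(b - a)\<^sup>2 / (F a - F b) < real n"
    using reals_Archimedean2 by blast
  then have n': "(b - a)\<^sup>2 < real n * (F a - F b)"
    using less by (simp add: pos_divide_less_eq)
  have n0: "n > 0"
  proof (rule ccontr)
    assume "\<not> n > 0"
    then show False using n' by simp
  qed
  define d where "d = (b - a) / n"
  have d0: "0 \<le> d" using ab by (simp add: d_def)
  have nd: "real n * d = b - a" using n0 by (simp add: d_def)
  have "k \<le> n \<Longrightarrow> F a - real k * d\<^sup>2 \<le> F (a + real k * d)" for k
  proof (induction k)
    case (Suc k)
    have "real (Suc k) * d \<le> real n * d" using Suc.prems d0 by (intro mult_right_mono) auto
    then have "F (a + real k * d) - (a + real (Suc k) * d - (a + real k * d))\<^sup>2 \<le> F (a + real (Suc k) * d)"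
      using d0 nd by (intro step) (auto simp: algebra_simps)
    then show ?case using Suc by (simp add: algebra_simps)
  qed simp
  from this[of n] have "F a - real n * d\<^sup>2 \<le> F b" using nd by simp
  moreover have "real n * d\<^sup>2 = (b - a)\<^sup>2 / n" using n0 by (simp add: d_def power2_eq_square)
  moreover have "(b - a)\<^sup>2 / n < F a - F b" using n' n0 by (simp add: pos_divide_less_eq mult.commute)
  ultimately show False by simp
qed

text \<open>Integrating the lower bound on the slopes \<open>G\<close> without assuming
  differentiability: after subtraction of the claimed quadratic minorant, \<open>\<phi>\<close>
  decreases by at most a quadratic error on each step.\<close>

lemma quadratic_growth_right:
  fixes \<phi> G :: "real \<Rightarrow> real"
  assumes cont: "continuous_on {a..b} \<phi>"
    and dense: "\<And>y z. a \<le> y \<Longrightarrow> y < z \<Longrightarrow> z \<le> b \<Longrightarrow> \<exists>d\<in>D. y < d \<and> d < z"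
    and subgradient: "\<And>d s. d \<in> D \<Longrightarrow> a \<le> d \<Longrightarrow> d \<le> s \<Longrightarrow> s \<le> b \<Longrightarrow> \<phi> d + G d * (s - d) \<le> \<phi> s"
    and mono: "\<And>d. d \<in> D \<Longrightarrow> a < d \<Longrightarrow> d \<le> b \<Longrightarrow> g + (d - a) \<le> G d"
    and ab: "a \<le> b"
  shows "\<phi> a + g * (b - a) + (b - a)\<^sup>2 / 2 \<le> \<phi> b"
proof -
  define F where "F x = \<phi> x - g * (x - a) - (x - a)\<^sup>2 / 2" for x
  have "F a \<le> F b"
  proof (rule nondecreasing_by_quadratic_error[OF _ ab])
    fix u x assume ux: "a \<le> u" "u \<le> x" "x \<le> b"
    show "F u - (x - u)\<^sup>2 \<le> F x"
    proof (cases "u = x")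
      case False
      define K where "K v = F x - F v + (x - v)\<^sup>2" for v
      have "0 \<le> K u"
      \<comment> \<open>Taking points beyond \<open>u\<close> ensures \<open>a < d\<close>, which
        \<open>mono\<close> demands.\<close>
      proof (rule nonneg_by_density[where D="D \<inter> {u<..}" and g=K and a=u and b=x])
        have "continuous_on {u..x} \<phi>"
          by (rule continuous_on_subset[OF cont]) (use ux in auto)
        then show "continuous_on {u..x} K" unfolding K_def F_def
          by (intro continuous_intros) auto
        show "\<exists>d\<in>D \<inter> {u<..}. y < d \<and> d < z" if "u \<le> y" "y < z" "z \<le> x" for y z
          using dense[of y z] that ux by fastforce
        fix d assume d: "d \<in> D \<inter> {u<..}" "u \<le> d" "d \<le> x"
        have "(g + (d - a)) * (x - d) \<le> G d * (x - d)"
          using mono[of d] d ux by (intro mult_right_mono) auto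
        moreover have "\<phi> d + G d * (x - d) \<le> \<phi> x" using subgradient[of d x] d ux by auto
        ultimately have "\<phi> d + (g + (d - a)) * (x - d) \<le> \<phi> x" by simp
        moreover have "K d = \<phi> x - (\<phi> d + (g + (d - a)) * (x - d)) + (x - d)\<^sup>2 / 2"
          by (simp add: K_def F_def power2_eq_square field_simps)
        ultimately show "0 \<le> K d" by simp
      qed (use ux False in auto)
      then show ?thesis by (simp add: K_def)
    qed simp
  qed
  then show ?thesis by (simp add: F_def)
qed

text \<open>Quadratic growth to both sides of a point \<open>d\<close> of \<open>D\<close> is
  evaluated at \<open>0\<close> and \<open>L\<close>; in the combination with weights
  \<open>L - d\<close> and \<open>d\<close> the slope \<open>G d\<close> cancels. Density and
  continuity give the other points.\<close>

lemma strongly_convex_by_density: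
  fixes \<phi> G :: "real \<Rightarrow> real"
  assumes cont: "continuous_on {0..L} \<phi>"
    and dense: "\<And>y z. 0 \<le> y \<Longrightarrow> y < z \<Longrightarrow> z \<le> L \<Longrightarrow> \<exists>d\<in>D. y < d \<and> d < z"
    and D: "D \<subseteq> {0..L}"
    and subgradient: "\<And>d s. d \<in> D \<Longrightarrow> 0 \<le> s \<Longrightarrow> s \<le> L \<Longrightarrow> \<phi> d + G d * (s - d) \<le> \<phi> s"
    and mono: "\<And>d e. d \<in> D \<Longrightarrow> e \<in> D \<Longrightarrow> d < e \<Longrightarrow> e - d \<le> G e - G d"
    and t: "0 \<le> t" "t \<le> L"
  shows "L * \<phi> t \<le> (L - t) * \<phi> 0 + t * \<phi> L - L * t * (L - t) / 2"
proof (cases "t = L")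
  case False
  have right: "\<phi> d + G d * (s - d) + (s - d)\<^sup>2 / 2 \<le> \<phi> s" if "d \<in> D" "d \<le> s" "s \<le> L" for d s
  proof (rule quadratic_growth_right[where D=D and G=G])
    have "0 \<le> d" using that D by auto
    then show "continuous_on {d..s} \<phi>" using that by (intro continuous_on_subset[OF cont]) auto
    show "\<exists>e\<in>D. y < e \<and> e < z" if "d \<le> y" "y < z" "z \<le> s" for y z
      using that \<open>0 \<le> d\<close> \<open>s \<le> L\<close> by (intro dense) auto
    show "\<phi> e + G e * (u - e) \<le> \<phi> u" if "e \<in> D" "d \<le> e" "e \<le> u" "u \<le> s" for e u
      using that \<open>0 \<le> d\<close> \<open>s \<le> L\<close> by (intro subgradient) auto
    show "G d + (e - d) \<le> G e" if "e \<in> D" "d < e" "e \<le> s" for e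
      using mono[OF \<open>d \<in> D\<close> that(1,2)] by simp
  qed fact
  have left: "\<phi> d + G d * (s - d) + (s - d)\<^sup>2 / 2 \<le> \<phi> s" if "d \<in> D" "s \<le> d" "0 \<le> s" for d s
  proof -
    \<comment> \<open>Growth to the left is growth to the right for the reflected function.\<close>
    have "\<phi> (- (- d)) + - G d * (- s - - d) + (- s - - d)\<^sup>2 / 2 \<le> \<phi> (- (- s))"
    proof (rule quadratic_growth_right[where D="uminus ` D" and G="\<lambda>x. - G (- x)"])
      have dL: "d \<le> L" using that D by auto
      show "continuous_on {- d..- s} (\<lambda>x. \<phi> (- x))"
        by (rule continuous_on_compose2[OF cont]) (use that dL in \<open>auto intro!: continuous_intros\<close>)
      show "\<exists>e\<in>uminus ` D. y < e \<and> e < z" if "- d \<le> y" "y < z" "z \<le> - s" for y z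
        using dense[of "- z" "- y"] that \<open>0 \<le> s\<close> dL by force
      show "\<phi> (- e) + - G (- e) * (u - e) \<le> \<phi> (- u)" if "e \<in> uminus ` D" "- d \<le> e" "e \<le> u" "u \<le> - s" for e u
        using subgradient[of "- e" "- u"] that \<open>0 \<le> s\<close> dL by (auto simp: algebra_simps)
      show "- G d + (e - - d) \<le> - G (- e)" if "e \<in> uminus ` D" "- d < e" "e \<le> - s" for e
        using mono[of "- e" d] that \<open>d \<in> D\<close> by auto
    qed (use that in simp)
    then show ?thesis by (simp add: algebra_simps power2_commute)
  qed
  have "0 \<le> (L - t) * \<phi> 0 + t * \<phi> L - L * t * (L - t) / 2 - L * \<phi> t"
  proof (rule nonneg_by_density[where D=D and a=0 and b=L
        and g="\<lambda>t. (L - t) * \<phi> 0 + t * \<phi> L - L * t * (L - t) / 2 - L * \<phi> t"])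
    show "continuous_on {0..L} (\<lambda>t. (L - t) * \<phi> 0 + t * \<phi> L - L * t * (L - t) / 2 - L * \<phi> t)"
      by (intro continuous_intros cont) auto
    fix d assume d: "d \<in> D" "0 \<le> d" "d \<le> L"
    have "(L - d) * (\<phi> d + G d * (0 - d) + (0 - d)\<^sup>2 / 2) \<le> (L - d) * \<phi> 0"
      using left[of d 0] d by (intro mult_left_mono) auto
    moreover have "d * (\<phi> d + G d * (L - d) + (L - d)\<^sup>2 / 2) \<le> d * \<phi> L"
      using right[of d L] d by (intro mult_left_mono) auto
    ultimately show "0 \<le> (L - d) * \<phi> 0 + d * \<phi> L - L * d * (L - d) / 2 - L * \<phi> d"
      by (simp add: field_simps power2_eq_square)
  qed (use dense t False in auto)
  then show ?thesis by simp
qed simp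

section \<open>A geodesic and a point in a Busemann convex space\<close>

lemma point_at_affine_geodesic:
  assumes geo: "geodesic_space X" and X: "x \<in> X" "y \<in> X" and m: "point_at X x y l m"
  obtains \<alpha> where "affine_geodesic X {0..1} \<alpha>" "\<alpha> 0 = x" "\<alpha> 1 = y" "\<alpha> l = m"
proof -
  obtain \<gamma> where \<gamma>: "geodesic_path X x y \<gamma>" "\<gamma> (l * dist x y) = m"
    using geodesic_path_through[OF geo X m] .
  note g = geodesic_pathD[OF \<gamma>(1)]
  have "affine_geodesic X {0..1} (\<lambda>t. \<gamma> (t * dist x y))"
    unfolding affine_geodesic_def
  proof (intro conjI exI[of _ "dist x y"] ballI)
    show "(\<lambda>t. \<gamma> (t * dist x y)) \<in> {0..1} \<rightarrow> X"
      using g(1) by (auto simp: mult_left_le_one_le)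
    fix s t :: real assume "s \<in> {0..1}" "t \<in> {0..1}"
    then have "dist (\<gamma> (s * dist x y)) (\<gamma> (t * dist x y)) = \<bar>s * dist x y - t * dist x y\<bar>"
      by (intro g(2)) (auto simp: mult_left_le_one_le)
    also have "\<dots> = dist x y * \<bar>s - t\<bar>"
      by (metis abs_mult abs_of_nonneg left_diff_distrib mult.commute zero_le_dist)
    finally show "dist (\<gamma> (s * dist x y)) (\<gamma> (t * dist x y)) = dist x y * \<bar>s - t\<bar>" .
  qed simp
  then show ?thesis using that[of "\<lambda>t. \<gamma> (t * dist x y)"] g(3,4) \<gamma>(2) by simp
qed

lemma busemann_point_at:
  assumes bus: "busemann_convex X" and X: "x \<in> X" "y \<in> X" "x' \<in> X" "y' \<in> X"
    and l: "0 \<le> l" "l \<le> 1" and m: "point_at X x y l m" and m': "point_at X x' y' l m'"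
  shows "dist m m' \<le> (1 - l) * dist x x' + l * dist y y'"
proof -
  have geo: "geodesic_space X" using bus by (simp add: busemann_convex_def)
  obtain \<alpha> where \<alpha>: "affine_geodesic X {0..1} \<alpha>" "\<alpha> 0 = x" "\<alpha> 1 = y" "\<alpha> l = m"
    using point_at_affine_geodesic[OF geo X(1,2) m] .
  obtain \<beta> where \<beta>: "affine_geodesic X {0..1} \<beta>" "\<beta> 0 = x'" "\<beta> 1 = y'" "\<beta> l = m'"
    using point_at_affine_geodesic[OF geo X(3,4) m'] .
  have "convex_on {0..1} (\<lambda>t. dist (\<alpha> t) (\<beta> t))"
    using bus \<alpha>(1) \<beta>(1) by (simp add: busemann_convex_def is_interval_cc)
  from convex_onD[OF this l, of 0 1] show ?thesis using \<alpha> \<beta> by simp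
qed

text \<open>\<open>pt\<close> fixes a choice of points at given fractions; by
  \<open>busemann\<close> there are no others.\<close>

locale busemann_geodesics =
  fixes X :: "'a::metric_space set" and pt :: "'a \<Rightarrow> 'a \<Rightarrow> real \<Rightarrow> 'a"
  assumes pt: "x \<in> X \<Longrightarrow> y \<in> X \<Longrightarrow> 0 \<le> l \<Longrightarrow> l \<le> 1 \<Longrightarrow> point_at X x y l (pt x y l)"
    and busemann: "x \<in> X \<Longrightarrow> y \<in> X \<Longrightarrow> x' \<in> X \<Longrightarrow> y' \<in> X \<Longrightarrow> 0 \<le> l \<Longrightarrow> l \<le> 1
      \<Longrightarrow> point_at X x y l m \<Longrightarrow> point_at X x' y' l m'
      \<Longrightarrow> dist m m' \<le> (1 - l) * dist x x' + l * dist y y'"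
begin

lemma point_at_unique:
  assumes "x \<in> X" "y \<in> X" "0 \<le> l" "l \<le> 1" "point_at X x y l m" "point_at X x y l m'"
  shows "m = m'"
  using busemann[OF assms(1,2,1-6)] by simp

text \<open>The point at fraction \<open>l / r\<close> between \<open>x\<close> and \<open>n\<close>
  has the distances from \<open>x\<close> and \<open>y\<close> that determine \<open>m\<close>, so
  uniqueness identifies the two.\<close>

lemma point_at_subsegment:
  assumes X: "x \<in> X" "y \<in> X" and lr: "0 \<le> l" "0 < r" "l \<le> r" "r \<le> 1"
    and m: "point_at X x y l m" and n: "point_at X x y r n"
  shows "point_at X x n (l / r) m"
proof -
  have nX: "n \<in> X" using n by (simp add: point_at_def)
  have lr1: "0 \<le> l / r" "l / r \<le> 1" using lr by simp_all
  define k where "k = pt x n (l / r)"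
  have k: "point_at X x n (l / r) k" unfolding k_def by (rule pt[OF X(1) nX lr1])
  have xn: "dist x n = r * dist x y" using n by (simp add: point_at_def)
  have "(1 - l / r) * r = r - l" using lr(2) by (simp add: left_diff_distrib)
  then have kn: "dist k n = (r - l) * dist x y"
    using k unfolding point_at_def xn mult.assoc[symmetric] by simp
  have xk: "dist x k = l * dist x y"
    using k lr(2) unfolding point_at_def xn by simp
  have "dist k y \<le> (1 - l) * dist x y"
    using dist_triangle[of k y n] kn n by (simp add: point_at_def algebra_simps)
  moreover have "(1 - l) * dist x y \<le> dist k y"
    using dist_triangle[of x y k] xk by (simp add: algebra_simps)
  ultimately have "point_at X x y l k"
    using k xk by (simp add: point_at_def)
  then have "m = k" using point_at_unique[OF X _ _ m] lr by simp
  then show ?thesis using k by simp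
qed

lemma point_at_dist:
  assumes X: "x \<in> X" "y \<in> X" and lr: "0 \<le> l" "l \<le> r" "r \<le> 1"
    and m: "point_at X x y l m" and n: "point_at X x y r n"
  shows "dist m n = (r - l) * dist x y"
proof (cases "r = 0")
  case False
  then have "point_at X x n (l / r) m" using point_at_subsegment[OF X _ _ _ _ m n] lr by simp
  then have "dist m n = (1 - l / r) * r * dist x y" using n by (simp add: point_at_def)
  moreover have "(1 - l / r) * r = r - l" using False by (simp add: left_diff_distrib)
  ultimately show ?thesis by simp
next
  case True
  have l: "l = 0" using True lr by simp
  have "dist x m = l * dist x y" "dist x n = r * dist x y" using m n unfolding point_at_def by blast+
  then have "m = x" "n = x" by (simp_all add: l True)
  then show ?thesis by (simp add: l True)
qed

end

section \<open>A geodesic \<open>c\<close>, a point \<open>p\<close> and their distances after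
  rescaling\<close>

locale geodesic_and_point = busemann_geodesics X pt
  for X :: "'a::metric_space set" and pt +
  fixes c :: "real \<Rightarrow> 'a" and L :: real and p :: 'a
  assumes c_in: "0 \<le> t \<Longrightarrow> t \<le> L \<Longrightarrow> c t \<in> X"
    and c_dist: "0 \<le> s \<Longrightarrow> s \<le> L \<Longrightarrow> 0 \<le> t \<Longrightarrow> t \<le> L \<Longrightarrow> dist (c s) (c t) = \<bar>s - t\<bar>"
    and p_in: "p \<in> X"
begin

definition h :: "real \<Rightarrow> real" where "h t = dist (c t) p"

text \<open>The geodesic from \<open>c t\<close> to \<open>p\<close>, parameterized by
  arclength.\<close>

definition R :: "real \<Rightarrow> real \<Rightarrow> 'a" where "R t s = pt (c t) p (s / h t)"

definition U :: "real set" where "U = {t. 0 < t \<and> t < L \<and> 0 < h t}"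

definition ok :: "real \<Rightarrow> real \<Rightarrow> real \<Rightarrow> real \<Rightarrow> bool" where
  "ok r t T a \<longleftrightarrow> 0 < r \<and> t \<in> U \<and> 0 \<le> t + r * T \<and> t + r * T \<le> L \<and> 0 \<le> a \<and> r * a \<le> h t"

text \<open>The distance, in the configuration enlarged by the factor \<open>1 / r\<close> at
  \<open>c t\<close>, from the point at position \<open>T\<close> along \<open>c\<close> to the
  point at height \<open>a\<close> on the geodesic to \<open>p\<close>.\<close>

definition q :: "real \<Rightarrow> real \<Rightarrow> real \<Rightarrow> real \<Rightarrow> real" where
  "q r t T a = dist (c (t + r * T)) (R t (r * a)) / r"

text \<open>Since \<open>q\<close> is monotone in \<open>r\<close>, this infimum is the limit for
  \<open>r\<close> tending to zero; as an infimum it bounds no actual distance from above, so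
  inequalities hold at every admissible scale.\<close>

definition \<rho> :: "real \<Rightarrow> real \<Rightarrow> real \<Rightarrow> real" where
  "\<rho> t T a = Inf ((\<lambda>r. q r t T a) ` {r. ok r t T a})"

lemma UD: "t \<in> U \<Longrightarrow> 0 < t" "t \<in> U \<Longrightarrow> t < L" "t \<in> U \<Longrightarrow> 0 < h t" "t \<in> U \<Longrightarrow> c t \<in> X"
  by (simp_all add: U_def c_in)

lemma h_nonneg [simp]: "0 \<le> h t" by (simp add: h_def)

lemma h_lipschitz: "0 \<le> s \<Longrightarrow> s \<le> L \<Longrightarrow> 0 \<le> t \<Longrightarrow> t \<le> L \<Longrightarrow> \<bar>h s - h t\<bar> \<le> \<bar>s - t\<bar>"
  using dist_triangle[of "c s" p "c t"] dist_triangle[of "c t" p "c s"] c_dist[of s t]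
  by (simp add: h_def dist_commute)

lemma continuous_h: "continuous_on {0..L} h"
proof (rule lipschitz_on_continuous_on)
  show "1-lipschitz_on {0..L} h"
  proof (rule lipschitz_onI)
    fix s t assume "s \<in> {0..L}" "t \<in> {0..L}"
    then show "dist (h s) (h t) \<le> 1 * dist s t" using h_lipschitz[of s t] by (simp add: dist_real_def)
  qed simp
qed

lemma R_point_at:
  assumes "t \<in> U" "0 \<le> s" "s \<le> h t"
  shows "point_at X (c t) p (s / h t) (R t s)"
  unfolding R_def using UD[OF assms(1)] assms p_in by (intro pt) auto

lemma R_in: "t \<in> U \<Longrightarrow> 0 \<le> s \<Longrightarrow> s \<le> h t \<Longrightarrow> R t s \<in> X"
  and dist_c_R: "t \<in> U \<Longrightarrow> 0 \<le> s \<Longrightarrow> s \<le> h t \<Longrightarrow> dist (c t) (R t s) = s"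
  and dist_R_p: "t \<in> U \<Longrightarrow> 0 \<le> s \<Longrightarrow> s \<le> h t \<Longrightarrow> dist (R t s) p = h t - s"
  using R_point_at[of t s] UD(3)[of t] by (simp_all add: point_at_def h_def field_simps)

lemma R_0: "t \<in> U \<Longrightarrow> R t 0 = c t"
  using dist_c_R[of t 0] by simp

lemma R_dist:
  assumes t: "t \<in> U" and s: "0 \<le> s" "s \<le> h t" and s': "0 \<le> s'" "s' \<le> h t"
  shows "dist (R t s) (R t s') = \<bar>s - s'\<bar>"
proof -
  have *: "dist (R t s) (R t s') = s' - s" if "0 \<le> s" "s \<le> s'" "s' \<le> h t" for s s'
  proof -
    have "dist (R t s) (R t s') = (s' / h t - s / h t) * h t"
      unfolding h_def[of t] using that UD[OF t] R_point_at[OF t, of s] R_point_at[OF t, of s']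
      by (intro point_at_dist[OF UD(4)[OF t] p_in]) (auto simp: h_def[symmetric] divide_right_mono)
    then show ?thesis using UD(3)[OF t] by (simp add: left_diff_distrib)
  qed
  show ?thesis
    using *[of s s'] *[of s' s] s s' by (cases "s \<le> s'") (auto simp: dist_commute)
qed

text \<open>Both \<open>c t\<close> and \<open>R t' (s' - s)\<close> are moved by the fraction \<open>s / h t\<close> towards \<open>p\<close>; the last summand
  accounts for the different lengths of the two geodesics.\<close>

lemma R_shrink:
  assumes t: "t \<in> U" "t' \<in> U" and s: "0 \<le> s" "s \<le> h t" "s \<le> s'" "s' \<le> h t'"
  shows "dist (R t s) (R t' s') \<le> dist (c t) (R t' (s' - s)) + s / h t * (\<bar>t - t'\<bar> + (s' - s))"
proof -
  define l where "l = s / h t"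
  have l: "0 \<le> l" "l \<le> 1" using s UD(3)[OF t(1)] by (simp_all add: l_def)
  define m where "m = R t' (s' - s)"
  \<comment> \<open>The height that \<open>m\<close> reaches when moved by the fraction
    \<open>l\<close> towards \<open>p\<close>; it differs from \<open>s'\<close> only through the
    lengths of the geodesics.\<close>
  define u where "u = s' - s + l * (h t' - (s' - s))"
  have lw: "0 \<le> l * (h t' - (s' - s))" "l * (h t' - (s' - s)) \<le> h t' - (s' - s)"
    using l s by (simp_all add: mult_left_le_one_le)
  then have u: "0 \<le> u" "u \<le> h t'" using s by (simp_all add: u_def)
  have mX: "m \<in> X" and mp: "dist m p = h t' - (s' - s)" and cm: "dist (c t') m = s' - s"
    unfolding m_def using R_in[OF t(2)] dist_R_p[OF t(2)] dist_c_R[OF t(2)] s by auto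
  have "point_at X m p l (R t' u)"
    unfolding point_at_def
  proof (intro conjI R_in[OF t(2) u])
    show "dist m (R t' u) = l * dist m p"
      unfolding m_def using R_dist[OF t(2), of "s' - s" u] u s lw mp by (simp add: u_def m_def)
    show "dist (R t' u) p = (1 - l) * dist m p"
      unfolding dist_R_p[OF t(2) u] mp by (simp add: u_def algebra_simps)
  qed
  then have "dist (R t s) (R t' u) \<le> (1 - l) * dist (c t) m + l * dist p p"
    using R_point_at[OF t(1) s(1,2)] l UD(4)[OF t(1)] mX p_in unfolding l_def[symmetric]
    by (intro busemann)
  also have "\<dots> \<le> dist (c t) m" using l by (simp add: mult_left_le_one_le)
  finally have 1: "dist (R t s) (R t' u) \<le> dist (c t) m" .
  have s_eq: "s = l * h t" using UD(3)[OF t(1)] by (simp add: l_def)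
  have "u - s' = l * (h t' - h t - (s' - s))" unfolding u_def using s_eq by (simp add: algebra_simps)
  then have "\<bar>u - s'\<bar> = l * \<bar>h t' - h t - (s' - s)\<bar>" using l by (simp add: abs_mult)
  also have "\<dots> \<le> l * (\<bar>t - t'\<bar> + (s' - s))"
    using h_lipschitz[of t' t] UD(1,2)[OF t(1)] UD(1,2)[OF t(2)] s l by (intro mult_left_mono) auto
  finally have "dist (R t' u) (R t' s') \<le> l * (\<bar>t - t'\<bar> + (s' - s))"
    using R_dist[OF t(2) u, of s'] s by simp
  then show ?thesis
    using 1 dist_triangle[of "R t s" "R t' s'" "R t' u"] by (simp add: m_def l_def)
qed

lemma R_continuous:
  assumes t: "t \<in> U" "t' \<in> U" and s: "0 \<le> s" "s \<le> h t" "s \<le> h t'"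
  shows "dist (R t s) (R t' s) \<le> 2 * \<bar>t - t'\<bar>"
proof -
  have "s / h t * \<bar>t - t'\<bar> \<le> \<bar>t - t'\<bar>"
    using s UD(3)[OF t(1)] by (intro mult_left_le_one_le) auto
  then show ?thesis
    using R_shrink[OF t s(1,2) order_refl s(3)] c_dist[of t t'] UD(1,2)[OF t(1)] UD(1,2)[OF t(2)]
    by (simp add: R_0[OF t(2)])
qed

lemma okD:
  assumes "ok r t T a" shows "0 < r" "t \<in> U" "0 \<le> t + r * T" "t + r * T \<le> L" "0 \<le> a" "r * a \<le> h t" "0 \<le> r * a"
  using assms by (auto simp: ok_def)

lemma ok_smaller:
  assumes ok: "ok r t T a" and r: "0 < r'" "r' \<le> r" shows "ok r' t T a"
proof -
  note o = okD[OF ok]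
  have "r' * a \<le> r * a" using r o(5) by (intro mult_right_mono)
  moreover have "0 \<le> t + r' * T \<and> t + r' * T \<le> L"
  proof (cases "0 \<le> T")
    case True
    then have "0 \<le> r' * T" "r' * T \<le> r * T" using r by (auto intro: mult_right_mono)
    then show ?thesis using o UD(1,2)[OF o(2)] by linarith
  next
    case False
    then have "r' * T \<le> 0" "r * T \<le> r' * T" using r by (auto intro: mult_right_mono_neg simp: mult_le_0_iff)
    then show ?thesis using o UD(1,2)[OF o(2)] by linarith
  qed
  ultimately show ?thesis using o r by (auto simp: ok_def)
qed

text \<open>Busemann convexity for two geodesics issuing from \<open>c t\<close>, both shortened by
  the factor \<open>r' / r\<close>.\<close>

lemma q_mono:
  assumes ok: "ok r t T a" and r: "0 < r'" "r' \<le> r" shows "q r' t T a \<le> q r t T a"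
proof -
  note o = okD[OF ok] and o' = okD[OF ok_smaller[OF ok r]]
  note u = UD[OF o(2)]
  define l where "l = r' / r"
  have l: "0 \<le> l" "l \<le> 1" "r' = l * r" using o(1) r by (simp_all add: l_def)
  have 1: "point_at X (c t) (c (t + r * T)) l (c (t + r' * T))"
  proof -
    have "dist (c t) (c (t + r' * T)) = l * \<bar>r * T\<bar>"
      "dist (c (t + r' * T)) (c (t + r * T)) = (1 - l) * \<bar>r * T\<bar>"
      "dist (c t) (c (t + r * T)) = \<bar>r * T\<bar>"
    proof -
      show "dist (c t) (c (t + r' * T)) = l * \<bar>r * T\<bar>"
        using c_dist[of t "t + r' * T"] o' u l by (simp add: abs_mult)
      have "dist (c (t + r' * T)) (c (t + r * T)) = \<bar>(l - 1) * (r * T)\<bar>"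
        using c_dist[of "t + r' * T" "t + r * T"] o o' l(3) by (simp add: algebra_simps)
      then show "dist (c (t + r' * T)) (c (t + r * T)) = (1 - l) * \<bar>r * T\<bar>"
        using l by (simp add: abs_mult)
      show "dist (c t) (c (t + r * T)) = \<bar>r * T\<bar>" using c_dist[of t "t + r * T"] o u by simp
    qed
    then show ?thesis using c_in o' by (simp add: point_at_def)
  qed
  have 2: "point_at X (c t) (R t (r * a)) l (R t (r' * a))"
  proof -
    have "dist (R t (r' * a)) (R t (r * a)) = \<bar>(l - 1) * (r * a)\<bar>"
      using R_dist[OF o(2) o'(7,6) o(7,6)] l(3) by (simp add: algebra_simps)
    then have "dist (R t (r' * a)) (R t (r * a)) = (1 - l) * (r * a)"
      using l o(1,5) by (simp add: abs_mult)
    then show ?thesis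
      using R_in[OF o(2) o'(7,6)] dist_c_R[OF o(2) o'(7,6)] dist_c_R[OF o(2) o(7,6)] l(3)
      by (simp add: point_at_def)
  qed
  have "dist (c (t + r' * T)) (R t (r' * a)) \<le> (1 - l) * dist (c t) (c t) + l * dist (c (t + r * T)) (R t (r * a))"
    by (rule busemann[OF _ _ _ _ l(1,2) 1 2]) (use u(4) c_in o R_in in auto)
  then show ?thesis
    unfolding q_def using o(1) r by (simp add: l_def field_simps)
qed

lemma ok_exists:
  assumes t: "t \<in> U" and a: "0 \<le> a"
  shows "\<exists>r. ok r t T a"
proof -
  \<comment> \<open>The summand 1 in the denominators covers \<open>T = 0\<close> and
    \<open>a = 0\<close>.\<close>
  define r where "r = min (min (t / (\<bar>T\<bar> + 1)) ((L - t) / (\<bar>T\<bar> + 1))) (h t / (a + 1))"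
  have r: "0 < r" using UD(1-3)[OF t] a by (simp add: r_def)
  have "r \<le> t / (\<bar>T\<bar> + 1)" "r \<le> (L - t) / (\<bar>T\<bar> + 1)" "r \<le> h t / (a + 1)"
    by (simp_all add: r_def)
  then have "r * (\<bar>T\<bar> + 1) \<le> t" "r * (\<bar>T\<bar> + 1) \<le> L - t" "r * (a + 1) \<le> h t"
    using a by (simp_all only: pos_le_divide_eq abs_ge_zero add_nonneg_pos zero_less_one)
  moreover have "\<bar>r * T\<bar> \<le> r * (\<bar>T\<bar> + 1)" "r * a \<le> r * (a + 1)" using r by (simp_all add: abs_mult)
  ultimately have "\<bar>r * T\<bar> \<le> t" "\<bar>r * T\<bar> \<le> L - t" "r * a \<le> h t" by linarith+
  then have "0 \<le> t + r * T \<and> t + r * T \<le> L \<and> r * a \<le> h t" by linarith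
  then show ?thesis
    using r t a by (intro exI[of _ r]) (simp add: ok_def)
qed

lemma q_nonneg: "ok r t T a \<Longrightarrow> 0 \<le> q r t T a"
  by (simp add: q_def ok_def)

lemma rho_le: "ok r t T a \<Longrightarrow> \<rho> t T a \<le> q r t T a"
  unfolding \<rho>_def by (rule cInf_lower) (auto intro!: bdd_belowI2[of _ 0] q_nonneg)

lemma rho_approx:
  assumes t: "t \<in> U" and a: "0 \<le> a" and K: "\<rho> t T a < K"
  shows "\<exists>r. ok r t T a \<and> q r t T a < K"
proof -
  have "(\<lambda>r. q r t T a) ` {r. ok r t T a} \<noteq> {}" using ok_exists[OF t a] by auto
  from cInf_lessD[OF this K[unfolded \<rho>_def]] show ?thesis by auto
qed

lemma q_tendsto:
  assumes t: "t \<in> U" and a: "0 \<le> a"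
  shows "((\<lambda>r. q r t T a) \<longlongrightarrow> \<rho> t T a) (at_right 0)"
proof (rule order_tendstoI)
  have ev: "\<forall>\<^sub>F r in at_right 0. 0 < r \<and> r \<le> r0" if "0 < r0" for r0 :: real
    using that by (auto simp: eventually_at_right intro!: exI[of _ r0])
  obtain r0 where r0: "ok r0 t T a" using ok_exists[OF t a] by blast
  fix K
  { assume K: "K < \<rho> t T a"
    show "\<forall>\<^sub>F r in at_right 0. K < q r t T a"
      using ev[OF okD(1)[OF r0]]
    proof eventually_elim
      case (elim r)
      then show ?case using rho_le[OF ok_smaller[OF r0]] K by fastforce
    qed }
  { assume K: "\<rho> t T a < K"
    then obtain r where r: "ok r t T a" "q r t T a < K" using rho_approx[OF t a] by blast
    show "\<forall>\<^sub>F r in at_right 0. q r t T a < K"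
      using ev[OF okD(1)[OF r(1)]]
    proof eventually_elim
      case (elim r')
      then show ?case using q_mono[OF r(1)] r(2) by fastforce
    qed }
qed

lemma open_U: "open U"
proof -
  have "U = {t \<in> {0<..<L}. 0 < h t}" by (auto simp: U_def)
  moreover have "open ({0<..<L} \<inter> h -` {0<..})"
    by (rule continuous_open_preimage) (auto intro: continuous_on_subset[OF continuous_h])
  ultimately show ?thesis by (simp add: vimage_def Int_def)
qed

section \<open>Upper semicontinuity and generic parameters\<close>

text \<open>At a fixed scale \<open>q\<close> is continuous in the base point. One scale serves a
  whole neighbourhood, which \<open>q_base_tendsto\<close> exploits.\<close>

lemma rho_usc:
  assumes t: "t \<in> U" and a: "0 \<le> a" and K: "\<rho> t T a < K"
  shows "\<exists>r>0. \<forall>\<^sub>F t' in nhds t. ok r t' T a \<and> q r t' T a < K"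
proof -
  obtain r1 where r1: "ok r1 t T a" "q r1 t T a < K" using rho_approx[OF t a K] by blast
  \<comment> \<open>Halving the scale makes the constraints in \<open>ok\<close> strict, hence
    stable under small changes of \<open>t\<close>.\<close>
  define r where "r = r1 / 2"
  note o1 = okD[OF r1(1)]
  note u = UD[OF t]
  have r: "0 < r" "r \<le> r1" using o1 by (simp_all add: r_def)
  have o: "ok r t T a" by (rule ok_smaller[OF r1(1) r])
  have q: "q r t T a < K" using q_mono[OF r1(1) r] r1(2) by simp
  have strict: "0 < t + r * T" "t + r * T < L" "r * a < h t"
    using o1(3,4,6) u(1-3) by (auto simp: r_def)
  define e where "e = (K - q r t T a) * r / 3"
  have e: "0 < e" using q r by (simp add: e_def)
  define d where "d = min (min (t + r * T) (L - (t + r * T))) (min (h t - r * a) e)"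
  have d: "0 < d" using strict e by (simp add: d_def)
  have "\<forall>\<^sub>F t' in nhds t. t' \<in> U \<and> dist t' t < d"
    using open_U t d by (intro eventually_conj eventually_nhds_in_open) (auto simp: eventually_nhds_metric)
  then have "\<forall>\<^sub>F t' in nhds t. ok r t' T a \<and> q r t' T a < K"
  proof eventually_elim
    case (elim t')
    then have t': "t' \<in> U" and td: "\<bar>t' - t\<bar> < d" by (auto simp: dist_real_def)
    have "\<bar>h t' - h t\<bar> \<le> \<bar>t' - t\<bar>" using h_lipschitz UD(1,2)[OF t'] u by simp
    then have ok': "ok r t' T a" using t' td r a by (auto simp: ok_def d_def)
    have "dist (c (t' + r * T)) (c (t + r * T)) = \<bar>t' - t\<bar>"
      using c_dist[of "t' + r * T" "t + r * T"] okD[OF ok'] okD[OF o] by simp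
    moreover have "dist (R t (r * a)) (R t' (r * a)) \<le> 2 * \<bar>t' - t\<bar>"
      using R_continuous[OF t t' okD(7)[OF o] okD(6)[OF o] okD(6)[OF ok']] by (simp add: abs_minus_commute)
    ultimately have "dist (c (t' + r * T)) (R t' (r * a)) \<le> dist (c (t + r * T)) (R t (r * a)) + 3 * \<bar>t' - t\<bar>"
      using dist_triangle[of "c (t' + r * T)" "R t' (r * a)" "c (t + r * T)"]
        dist_triangle[of "c (t + r * T)" "R t' (r * a)" "R t (r * a)"] by simp
    also have "\<dots> < dist (c (t + r * T)) (R t (r * a)) + 3 * e" using td by (simp add: d_def)
    also have "\<dots> = K * r" using r by (simp add: e_def q_def field_simps)
    finally have "q r t' T a < K" using r by (simp add: q_def pos_divide_less_eq)
    then show ?case using ok' by simp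
  qed
  then show ?thesis using r by blast
qed

definition sublevel :: "real \<Rightarrow> real \<Rightarrow> real \<Rightarrow> real set" where
  "sublevel T a K = {t \<in> U. \<rho> t T a < K}"

lemma open_sublevel: "0 \<le> a \<Longrightarrow> open (sublevel T a K)"
proof -
  assume a: "0 \<le> a"
  have "\<exists>V. open V \<and> t \<in> V \<and> V \<subseteq> sublevel T a K" if "t \<in> sublevel T a K" for t
  proof -
    have "t \<in> U" "\<rho> t T a < K" using that by (auto simp: sublevel_def)
    then obtain r where "\<forall>\<^sub>F t' in nhds t. ok r t' T a \<and> q r t' T a < K" using rho_usc[OF _ a] by blast
    then have "\<forall>\<^sub>F t' in nhds t. t' \<in> sublevel T a K"
    proof eventually_elim
      case (elim t')
      then show ?case using rho_le[of r t' T a] okD(2)[of r t' T a] by (auto simp: sublevel_def)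
    qed
    then show ?thesis unfolding eventually_nhds by blast
  qed
  then show ?thesis by (subst open_subopen) blast
qed

text \<open>By upper semicontinuity, \<open>\<lambda>t. \<rho> t T a\<close> is lower semicontinuous off the frontiers of its
  sublevel sets.\<close>

definition generic :: "real set" where
  "generic = {t \<in> U. \<forall>T\<in>\<rat>. \<forall>a\<in>\<rat>. \<forall>K\<in>\<rat>. 0 \<le> a \<longrightarrow> t \<notin> frontier (sublevel T a K)}"

lemma genericD: "t \<in> generic \<Longrightarrow> t \<in> U" by (simp add: generic_def)

text \<open>Baire's theorem: frontiers of open sets have empty interior, and there are countably
  many of them. Within \<open>U\<close> nothing is lost, as \<open>c\<close> meets \<open>p\<close>
  at most once.\<close>

lemma generic_dense:
  assumes y: "0 \<le> y" "y < z" "z \<le> L"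
  shows "\<exists>d\<in>generic. y < d \<and> d < z"
proof -
  define f where "f = (\<lambda>(T, a, K). - frontier (sublevel T a K))"
  define G where "G = f ` {x \<in> \<rat> \<times> \<rat> \<times> \<rat>. 0 \<le> fst (snd x)}"
  have cG: "countable G" unfolding G_def
    by (intro countable_image countable_subset[OF _ countable_SIGMA[OF countable_rat countable_SIGMA[OF countable_rat countable_rat]]]) auto
  have "UNIV \<subseteq> closure (\<Inter>G)"
  proof (rule Baire[OF closed_UNIV cG])
    fix S assume "S \<in> G"
    then obtain T a K where "0 \<le> a" and S: "S = - frontier (sublevel T a K)" by (auto simp: G_def f_def)
    define W where "W = interior (frontier (sublevel T a K))"
    have "W \<inter> sublevel T a K = {}"
      using frontier_disjoint_eq[of "sublevel T a K"] open_sublevel[OF \<open>0 \<le> a\<close>] interior_subset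
      by (fastforce simp: W_def)
    then have "W \<inter> closure (sublevel T a K) = {}"
      by (subst open_Int_closure_eq_empty) (simp_all add: W_def)
    moreover have "W \<subseteq> closure (sublevel T a K)"
      using interior_subset unfolding W_def frontier_def by blast
    ultimately have "interior (frontier (sublevel T a K)) = {}" unfolding W_def by blast
    then show "openin (top_of_set UNIV) S \<and> UNIV \<subseteq> closure S"
      unfolding S by (simp add: closure_complement open_Compl)
  qed
  then have cl: "closure (\<Inter>G) = UNIV" by auto
  define V where "V = U \<inter> {y<..<z}"
  have "V \<noteq> {}"
  proof -
    define s t where "s = y + (z - y) / 3" and "t = y + 2 * (z - y) / 3"
    have st: "y < s" "s < t" "t < z" using y by (simp_all add: s_def t_def field_simps)
    have "0 < h s \<or> 0 < h t"
    proof (rule ccontr)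
      assume "\<not> (0 < h s \<or> 0 < h t)"
      then have "c s = p" "c t = p" by (simp_all add: h_def)
      then show False using c_dist[of s t] st y by simp
    qed
    then have "s \<in> V \<or> t \<in> V" using st y by (simp add: V_def U_def)
    then show ?thesis by blast
  qed
  moreover have "open V" by (simp add: V_def open_U open_Int)
  ultimately have "V \<inter> \<Inter>G \<noteq> {}"
    using open_Int_closure_eq_empty[of V "\<Inter>G"] cl by auto
  then obtain d where d: "d \<in> V" "\<And>S. S \<in> G \<Longrightarrow> d \<in> S" by blast
  have "d \<in> generic"
    unfolding generic_def
  proof (intro CollectI conjI ballI impI)
    show "d \<in> U" using d by (simp add: V_def)
    fix T a K :: real assume "T \<in> \<rat>" "a \<in> \<rat>" "K \<in> \<rat>" "0 \<le> a"
    then have "f (T, a, K) \<in> G" unfolding G_def by (intro imageI) simp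
    then show "d \<notin> frontier (sublevel T a K)" using d(2) by (auto simp: f_def)
  qed
  then show ?thesis using d by (auto simp: V_def)
qed

text \<open>The triangle inequality in the limit. It allows real parameters to be replaced by nearby
  rational ones.\<close>

lemma rho_lipschitz:
  assumes t: "t \<in> U" and a: "0 \<le> a" "0 \<le> a'"
  shows "\<rho> t T a \<le> \<rho> t T' a' + (\<bar>T - T'\<bar> + \<bar>a - a'\<bar>)"
proof (rule tendsto_le[OF trivial_limit_at_right_real])
  show "((\<lambda>r. q r t T a) \<longlongrightarrow> \<rho> t T a) (at_right 0)" by (rule q_tendsto[OF t a(1)])
  show "((\<lambda>r. q r t T' a' + (\<bar>T - T'\<bar> + \<bar>a - a'\<bar>)) \<longlongrightarrow> \<rho> t T' a' + (\<bar>T - T'\<bar> + \<bar>a - a'\<bar>)) (at_right 0)"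
    by (intro tendsto_intros q_tendsto[OF t a(2)])
  obtain r1 r2 where r: "ok r1 t T a" "ok r2 t T' a'" using ok_exists[OF t a(1)] ok_exists[OF t a(2)] by blast
  have "0 < min r1 r2" using okD(1)[OF r(1)] okD(1)[OF r(2)] by simp
  then have "\<forall>\<^sub>F r in at_right 0. 0 < r \<and> r \<le> min r1 r2"
    by (auto simp: eventually_at_right intro!: exI[of _ "min r1 r2"])
  then show "\<forall>\<^sub>F r in at_right 0. q r t T a \<le> q r t T' a' + (\<bar>T - T'\<bar> + \<bar>a - a'\<bar>)"
  proof eventually_elim
    case (elim r)
    then have o: "ok r t T a" and o': "ok r t T' a'" using ok_smaller[OF r(1)] ok_smaller[OF r(2)] by auto
    have e1: "\<bar>t + r * T - (t + r * T')\<bar> = r * \<bar>T - T'\<bar>"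
      using elim by (simp add: abs_mult flip: right_diff_distrib)
    have e2: "\<bar>r * a' - r * a\<bar> = r * \<bar>a - a'\<bar>"
      using elim by (simp add: abs_mult abs_minus_commute flip: right_diff_distrib)
    have "dist (c (t + r * T)) (c (t + r * T')) = r * \<bar>T - T'\<bar>"
      using c_dist[of "t + r * T" "t + r * T'"] okD[OF o] okD[OF o'] unfolding e1 by simp
    moreover have "dist (R t (r * a')) (R t (r * a)) = r * \<bar>a - a'\<bar>"
      using R_dist[OF t, of "r * a'" "r * a"] okD[OF o] okD[OF o'] unfolding e2 by simp
    ultimately have "dist (c (t + r * T)) (R t (r * a)) \<le> dist (c (t + r * T')) (R t (r * a')) + r * (\<bar>T - T'\<bar> + \<bar>a - a'\<bar>)"
      using dist_triangle[of "c (t + r * T)" "R t (r * a)" "c (t + r * T')"]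
        dist_triangle[of "c (t + r * T')" "R t (r * a)" "R t (r * a')"]
      by (simp add: dist_commute distrib_left)
    then show ?case using elim by (simp add: q_def field_simps)
  qed
qed

lemma rho_lsc:
  assumes t: "t \<in> generic" and a: "0 \<le> a" and K: "K < \<rho> t T a"
  shows "\<forall>\<^sub>F t' in nhds t. t' \<in> U \<longrightarrow> K < \<rho> t' T a"
proof -
  note tU = genericD[OF t]
  \<comment> \<open>Of the five parts of the gap, less than two are lost in each passage between
    \<open>(T, a)\<close> and \<open>(T', a')\<close>, and \<open>K'\<close> lies in the middle
    part.\<close>
  define e where "e = (\<rho> t T a - K) / 5"
  have e: "0 < e" using K by (simp add: e_def)
  have e5: "5 * e = \<rho> t T a - K" by (simp add: e_def)
  obtain T' where T': "T' \<in> \<rat>" "T - e < T'" "T' < T" using Rats_dense_in_real[of "T - e" T] e by auto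
  obtain a' where a': "a' \<in> \<rat>" "a < a'" "a' < a + e" using Rats_dense_in_real[of a "a + e"] e by auto
  obtain K' where K': "K' \<in> \<rat>" "K + 2 * e < K'" "K' < K + 3 * e"
    using Rats_dense_in_real[of "K + 2 * e" "K + 3 * e"] e by auto
  have a'0: "0 \<le> a'" using a a' by simp
  have d: "\<bar>T - T'\<bar> + \<bar>a - a'\<bar> < 2 * e" "\<bar>T' - T\<bar> + \<bar>a' - a\<bar> < 2 * e" using T' a' by auto
  have "K' \<le> \<rho> t T' a'"
    using rho_lipschitz[OF tU a a'0, of T T'] d(1) K'(3) e5 by linarith
  then have "t \<notin> sublevel T' a' K'" by (simp add: sublevel_def)
  moreover have "t \<notin> frontier (sublevel T' a' K')"
    using t T' a' a'0 K' by (simp add: generic_def)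
  ultimately have "t \<in> - closure (sublevel T' a' K')"
    using interior_open[OF open_sublevel[OF a'0]] by (auto simp: frontier_def)
  then have "\<forall>\<^sub>F t' in nhds t. t' \<in> - closure (sublevel T' a' K')"
    by (intro eventually_nhds_in_open) auto
  then show ?thesis
  proof eventually_elim
    case (elim t')
    show ?case
    proof
      assume u: "t' \<in> U"
      have "t' \<notin> sublevel T' a' K'" using elim closure_subset by auto
      then have "K' \<le> \<rho> t' T' a'" using u by (simp add: sublevel_def)
      then show "K < \<rho> t' T a"
        using rho_lipschitz[OF u a'0 a, of T' T] d(2) K'(2) by linarith
    qed
  qed
qed

section \<open>The tangent seminorm at a generic point\<close>

lemma eventually_base:
  fixes t0 \<tau> :: real
  assumes "\<forall>\<^sub>F t in nhds t0. Q t"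
  shows "\<forall>\<^sub>F r in at_right 0. Q (t0 + r * \<tau>)"
proof -
  have "((\<lambda>r. t0 + r * \<tau>) \<longlongrightarrow> t0 + 0 * \<tau>) (at_right 0)" by (intro tendsto_intros)
  then have "filterlim (\<lambda>r. t0 + r * \<tau>) (nhds t0) (at_right 0)" by simp
  with assms show ?thesis by (rule eventually_compose_filterlim)
qed

lemma eventually_small: "0 < r0 \<Longrightarrow> \<forall>\<^sub>F r in at_right (0::real). 0 < r \<and> r \<le> r0"
  by (auto simp: eventually_at_right intro!: exI[of _ r0])

lemma eventually_valid:
  assumes t: "t0 \<in> U" and a: "0 \<le> a"
  shows "\<forall>\<^sub>F r in at_right 0. 0 < r \<and> t0 + r * \<tau> \<in> U \<and> r * a \<le> h (t0 + r * \<tau>) \<and> h t0 / 2 \<le> h (t0 + r * \<tau>)"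
proof -
  note u = UD[OF t]
  have "\<forall>\<^sub>F t in nhds t0. dist t t0 < h t0 / 2"
    using u unfolding eventually_nhds_metric by (intro exI[of _ "h t0 / 2"]) simp
  then have "\<forall>\<^sub>F t in nhds t0. t \<in> U \<and> dist t t0 < h t0 / 2"
    by (intro eventually_conj eventually_nhds_in_open open_U t)
  then have "\<forall>\<^sub>F r in at_right 0. t0 + r * \<tau> \<in> U \<and> dist (t0 + r * \<tau>) t0 < h t0 / 2"
    by (rule eventually_base)
  moreover have "0 < h t0 / (2 * (a + 1))" using u a by simp
  then have "\<forall>\<^sub>F r in at_right 0. 0 < r \<and> r \<le> h t0 / (2 * (a + 1))" by (rule eventually_small)
  ultimately show ?thesis
  proof eventually_elim
    case (elim r)
    have "\<bar>h (t0 + r * \<tau>) - h t0\<bar> \<le> \<bar>t0 + r * \<tau> - t0\<bar>"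
      using elim UD(1,2)[of "t0 + r * \<tau>"] u by (intro h_lipschitz) auto
    then have 1: "h t0 / 2 \<le> h (t0 + r * \<tau>)"
      using elim(1) unfolding dist_real_def by linarith
    have "r * (2 * (a + 1)) \<le> h t0" using elim a by (simp add: pos_le_divide_eq)
    then have "r * a \<le> h t0 / 2" using elim by (simp add: algebra_simps)
    then show ?case using elim 1 by simp
  qed
qed

lemma eventually_ok:
  assumes t: "t0 \<in> U" and a: "0 \<le> a"
  shows "\<forall>\<^sub>F r in at_right 0. ok r (t0 + r * \<tau>) T a"
  using eventually_valid[OF t a, of \<tau>] eventually_valid[OF t order_refl, of "\<tau> + T"]
proof eventually_elim
  case (elim r)
  then show ?case using a UD(1,2)[of "t0 + r * (\<tau> + T)"] by (simp add: ok_def algebra_simps)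
qed

text \<open>The base point may move with the scale. From below, \<open>q\<close> is bounded by
  \<open>\<rho>\<close>, which is lower semicontinuous at generic points; from above, a common scale
  from \<open>rho_usc\<close> combines with \<open>q_mono\<close>.\<close>

lemma q_base_tendsto:
  assumes t: "t0 \<in> generic" and a: "0 \<le> a"
  shows "((\<lambda>r. q r (t0 + r * \<tau>) T a) \<longlongrightarrow> \<rho> t0 T a) (at_right 0)"
proof (rule order_tendstoI)
  note tU = genericD[OF t]
  fix K
  { assume K: "K < \<rho> t0 T a"
    show "\<forall>\<^sub>F r in at_right 0. K < q r (t0 + r * \<tau>) T a"
      using eventually_base[OF rho_lsc[OF t a K], of \<tau>] eventually_ok[OF tU a, of \<tau> T]
    proof eventually_elim
      case (elim r)
      then show ?case using rho_le[OF elim(2)] okD(2)[OF elim(2)] by simp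
    qed }
  { assume K: "\<rho> t0 T a < K"
    then obtain r0 where r0: "0 < r0" "\<forall>\<^sub>F t' in nhds t0. ok r0 t' T a \<and> q r0 t' T a < K"
      using rho_usc[OF tU a] by blast
    show "\<forall>\<^sub>F r in at_right 0. q r (t0 + r * \<tau>) T a < K"
      using eventually_base[OF r0(2), of \<tau>] eventually_small[OF r0(1)]
    proof eventually_elim
      case (elim r)
      then show ?case using q_mono[of r0 "t0 + r * \<tau>" T a r] by simp
    qed }
qed

lemma rho_scale:
  assumes t: "t \<in> U" and a: "0 \<le> a" and s: "0 < s"
  shows "\<rho> t (s * T) (s * a) = s * \<rho> t T a"
proof (rule tendsto_unique[OF trivial_limit_at_right_real])
  have "((\<lambda>r. s * q (r * s) t T a) \<longlongrightarrow> s * \<rho> t T a) (at_right 0)"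
  proof (intro tendsto_intros filterlim_compose[OF q_tendsto[OF t a]])
    show "filterlim (\<lambda>r. r * s) (at_right 0) (at_right 0)"
      using s eventually_at_right_less[of "0::real"]
      by (auto simp: filterlim_at intro!: tendsto_eq_intros elim: eventually_mono)
  qed
  then show "((\<lambda>r. q r t (s * T) (s * a)) \<longlongrightarrow> s * \<rho> t T a) (at_right 0)"
    using s by (simp add: q_def mult.assoc)
qed (use q_tendsto[OF t, of "s * a" "s * T"] a s in simp)

lemma rho_right: "t \<in> U \<Longrightarrow> \<rho> t T 0 = \<bar>T\<bar>"
proof (rule tendsto_unique[OF trivial_limit_at_right_real])
  assume t: "t \<in> U"
  show "((\<lambda>r. q r t T 0) \<longlongrightarrow> \<rho> t T 0) (at_right 0)" by (rule q_tendsto[OF t order_refl])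
  show "((\<lambda>r. q r t T 0) \<longlongrightarrow> \<bar>T\<bar>) (at_right 0)"
  proof (rule tendsto_eventually)
    show "\<forall>\<^sub>F r in at_right 0. q r t T 0 = \<bar>T\<bar>"
      using eventually_ok[OF t order_refl, of 0 T]
    proof eventually_elim
      case (elim r)
      have "dist (c (t + r * T)) (c t) = \<bar>r * T\<bar>"
        using c_dist[of "t + r * T" t] okD[OF elim] UD[OF t] by simp
      then show ?case using okD(1)[OF elim] by (simp add: q_def R_0[OF t] abs_mult)
    qed
  qed
qed

lemma rho_up: "t \<in> U \<Longrightarrow> 0 \<le> a \<Longrightarrow> \<rho> t 0 a = a"
proof (rule tendsto_unique[OF trivial_limit_at_right_real])
  assume t: "t \<in> U" and a: "0 \<le> a"
  show "((\<lambda>r. q r t 0 a) \<longlongrightarrow> \<rho> t 0 a) (at_right 0)" by (rule q_tendsto[OF t a])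
  show "((\<lambda>r. q r t 0 a) \<longlongrightarrow> a) (at_right 0)"
  proof (rule tendsto_eventually)
    show "\<forall>\<^sub>F r in at_right 0. q r t 0 a = a"
      using eventually_ok[OF t a, of 0 0]
    proof eventually_elim
      case (elim r)
      then have "ok r t 0 a" by simp
      from okD[OF this] show ?case by (simp add: q_def dist_c_R[OF t])
    qed
  qed
qed

text \<open>Coordinates of a half-plane at scale \<open>r\<close>: \<open>fst z\<close> is the
  position along \<open>c\<close>, \<open>snd z\<close> the height on the geodesic towards
  \<open>p\<close>.\<close>

definition P :: "real \<Rightarrow> real \<Rightarrow> real \<times> real \<Rightarrow> 'a" where
  "P t r z = R (t + r * fst z) (r * snd z)"

text \<open>Only points with nonnegative second coordinate are realized by \<open>P\<close>; vectors pointing down are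
  reflected.\<close>

definition N :: "real \<Rightarrow> real \<times> real \<Rightarrow> real" where
  "N t z = (if 0 \<le> snd z then \<rho> t (- fst z) (snd z) else \<rho> t (fst z) (- snd z))"

lemma N_minus: "t \<in> U \<Longrightarrow> N t (- z) = N t z"
  by (cases "snd z = 0") (auto simp: N_def rho_right)

text \<open>A point at height 0 lies on \<open>c\<close>, so this is \<open>q\<close> with the base
  point of the other point.\<close>

lemma P_bottom_tendsto:
  assumes t: "t \<in> generic" and a: "0 \<le> a"
  shows "((\<lambda>r. dist (P t r (\<tau>, 0)) (P t r (\<tau>', a)) / r) \<longlongrightarrow> \<rho> t (\<tau> - \<tau>') a) (at_right 0)"
proof (rule Lim_transform_eventually[OF q_base_tendsto[OF t a]])
  show "\<forall>\<^sub>F r in at_right 0. q r (t + r * \<tau>') (\<tau> - \<tau>') a = dist (P t r (\<tau>, 0)) (P t r (\<tau>', a)) / r"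
    using eventually_valid[OF genericD[OF t] order_refl, of \<tau>]
  proof eventually_elim
    case (elim r)
    then show ?case by (simp add: q_def P_def R_0 algebra_simps)
  qed
qed

text \<open>The upper bound comes from \<open>R_shrink\<close>. For the lower bound, the segment from \<open>(\<tau>, a)\<close> to
  \<open>(\<tau>', a')\<close> is prolonged backwards to the line at height 0, where the limits are known, and the
  triangle inequality is applied.\<close>

lemma P_tendsto_strict:
  assumes t: "t \<in> generic" and a: "0 \<le> a" "a < a'"
  shows "((\<lambda>r. dist (P t r (\<tau>, a)) (P t r (\<tau>', a')) / r) \<longlongrightarrow> \<rho> t (\<tau> - \<tau>') (a' - a)) (at_right 0)"
proof -
  note tU = genericD[OF t]
  have a': "0 \<le> a'" "0 \<le> a' - a" using a by auto
  define \<delta> where "\<delta> \<tau> a \<tau>' a' r = dist (P t r (\<tau>, a)) (P t r (\<tau>', a')) / r" for \<tau> a \<tau>' a' r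
  \<comment> \<open>The error in \<open>R_shrink\<close> is of second order in \<open>r\<close>,
    since \<open>h\<close> stays above \<open>h t / 2\<close> near \<open>t\<close>.\<close>
  define C where "C = 2 * a / h t * (\<bar>\<tau> - \<tau>'\<bar> + (a' - a))"
  have upper: "\<forall>\<^sub>F r in at_right 0. \<delta> \<tau> a \<tau>' a' r \<le> \<delta> \<tau> 0 \<tau>' (a' - a) r + r * C"
    using eventually_valid[OF tU a(1), of \<tau>] eventually_valid[OF tU a'(1), of \<tau>']
  proof eventually_elim
    case (elim r)
    have ht: "0 < h t" using UD(3)[OF tU] .
    have ra: "0 \<le> r * a" "r * a \<le> r * a'" using elim a by (auto intro: mult_left_mono)
    have "\<bar>t + r * \<tau> - (t + r * \<tau>')\<bar> = r * \<bar>\<tau> - \<tau>'\<bar>"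
      using elim by (simp add: abs_mult flip: right_diff_distrib)
    then have eqs: "\<bar>t + r * \<tau> - (t + r * \<tau>')\<bar> + (r * a' - r * a) = r * (\<bar>\<tau> - \<tau>'\<bar> + (a' - a))"
      by (simp add: algebra_simps)
    have "dist (P t r (\<tau>, a)) (P t r (\<tau>', a')) \<le> dist (P t r (\<tau>, 0)) (P t r (\<tau>', a' - a))
        + r * a / h (t + r * \<tau>) * (r * (\<bar>\<tau> - \<tau>'\<bar> + (a' - a)))"
      using R_shrink[of "t + r * \<tau>" "t + r * \<tau>'" "r * a" "r * a'"] elim ra
      unfolding eqs by (simp add: P_def R_0 right_diff_distrib)
    also have "r * a / h (t + r * \<tau>) * (r * (\<bar>\<tau> - \<tau>'\<bar> + (a' - a)))
        \<le> r * a / (h t / 2) * (r * (\<bar>\<tau> - \<tau>'\<bar> + (a' - a)))"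
      using elim a ht ra by (intro mult_right_mono divide_left_mono mult_pos_pos) auto
    also have "\<dots> = r * (r * C)" by (simp add: C_def)
    finally show ?case using elim by (simp add: \<delta>_def field_simps)
  qed
  have upper_lim: "((\<lambda>r. \<delta> \<tau> 0 \<tau>' (a' - a) r + r * C) \<longlongrightarrow> \<rho> t (\<tau> - \<tau>') (a' - a)) (at_right 0)"
  proof -
    have "((\<lambda>r. r * C) \<longlongrightarrow> 0) (at_right 0)" by (auto intro!: tendsto_eq_intros)
    from tendsto_add[OF P_bottom_tendsto[OF t a'(2)] this] show ?thesis by (simp add: \<delta>_def)
  qed
  have triangle: "\<forall>\<^sub>F r in at_right 0. \<delta> \<sigma> b \<tau>' a' r - \<delta> \<sigma> b \<tau> a r \<le> \<delta> \<tau> a \<tau>' a' r" for \<sigma> b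
    using eventually_small[OF zero_less_one]
  proof eventually_elim
    case (elim r)
    then show ?case
      using dist_triangle[of "P t r (\<sigma>, b)" "P t r (\<tau>', a')" "P t r (\<tau>, a)"]
      by (simp add: \<delta>_def divide_right_mono flip: diff_divide_distrib)
  qed
  \<comment> \<open>The line through the two points meets height 0 at position
    \<open>\<tau> - a * w\<close>.\<close>
  define w where "w = (\<tau>' - \<tau>) / (a' - a)"
  have wd: "w * (a' - a) = \<tau>' - \<tau>" using a by (simp add: w_def)
  \<comment> \<open>Along this line limit distances are proportional to differences of height, so
    the triangle inequality loses nothing.\<close>
  have scl: "\<rho> t (s * - w) s = s * \<rho> t (- w) 1" if "0 \<le> s" for s
    using rho_scale[OF tU zero_le_one, of s "- w"] rho_right[OF tU, of 0] that by (cases "s = 0") auto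
  have e1: "\<rho> t (\<tau> - a * w - \<tau>') a' = a' * \<rho> t (- w) 1"
  proof -
    have "\<tau> - a * w - \<tau>' = a' * - w" using wd by (simp add: algebra_simps)
    then show ?thesis using scl[OF a'(1)] by simp
  qed
  have e2: "\<rho> t (\<tau> - a * w - \<tau>) a = a * \<rho> t (- w) 1" using scl[OF a(1)] by simp
  have e3: "\<rho> t (\<tau> - \<tau>') (a' - a) = (a' - a) * \<rho> t (- w) 1"
  proof -
    have "\<tau> - \<tau>' = (a' - a) * - w" using wd by (simp add: algebra_simps)
    then show ?thesis using scl[OF a'(2)] by simp
  qed
  have "((\<lambda>r. \<delta> (\<tau> - a * w) 0 \<tau>' a' r - \<delta> (\<tau> - a * w) 0 \<tau> a r) \<longlongrightarrow> \<rho> t (\<tau> - \<tau>') (a' - a)) (at_right 0)"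
    using tendsto_diff[OF P_bottom_tendsto[OF t a'(1)] P_bottom_tendsto[OF t a(1)], of "\<tau> - a * w" \<tau>' "\<tau> - a * w" \<tau>]
    unfolding \<delta>_def e3 left_diff_distrib e1 e2 .
  then have "(\<delta> \<tau> a \<tau>' a' \<longlongrightarrow> \<rho> t (\<tau> - \<tau>') (a' - a)) (at_right 0)"
    using tendsto_sandwich[OF triangle[of "\<tau> - a * w" 0] upper _ upper_lim] by simp
  then show ?thesis by (simp add: \<delta>_def[abs_def])
qed

text \<open>For equal heights the second point is raised by a small \<open>e\<close>, which changes
  quotients and limit by at most \<open>e\<close>.\<close>

lemma P_tendsto_ordered:
  assumes t: "t \<in> generic" and a: "0 \<le> a" "a \<le> a'"
  shows "((\<lambda>r. dist (P t r (\<tau>, a)) (P t r (\<tau>', a')) / r) \<longlongrightarrow> \<rho> t (\<tau> - \<tau>') (a' - a)) (at_right 0)"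
proof (cases "a = a'")
  case True
  note tU = genericD[OF t]
  define \<delta> where "\<delta> b r = dist (P t r (\<tau>, a)) (P t r (\<tau>', b)) / r" for b r
  have near: "\<forall>\<^sub>F r in at_right 0. \<bar>\<delta> a r - \<delta> (a + e) r\<bar> \<le> e" if "0 < e" for e
    using eventually_valid[OF tU add_nonneg_nonneg[OF a(1) less_imp_le[OF that]], of \<tau>']
  proof eventually_elim
    case r: (elim r)
    have re: "0 \<le> r * a" "r * a \<le> r * (a + e)" using r a that by auto
    have "dist (P t r (\<tau>', a)) (P t r (\<tau>', a + e)) = r * e"
      using R_dist[of "t + r * \<tau>'" "r * a" "r * (a + e)"] r re by (simp add: P_def algebra_simps)
    then have "\<bar>dist (P t r (\<tau>, a)) (P t r (\<tau>', a)) - dist (P t r (\<tau>, a)) (P t r (\<tau>', a + e))\<bar> \<le> r * e"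
      using dist_triangle[of "P t r (\<tau>, a)" "P t r (\<tau>', a)" "P t r (\<tau>', a + e)"]
        dist_triangle[of "P t r (\<tau>, a)" "P t r (\<tau>', a + e)" "P t r (\<tau>', a)"] by (simp add: dist_commute)
    then show "\<bar>\<delta> a r - \<delta> (a + e) r\<bar> \<le> e"
      using r by (simp add: \<delta>_def abs_le_iff field_simps)
  qed
  have "(\<delta> a \<longlongrightarrow> \<rho> t (\<tau> - \<tau>') 0) (at_right 0)"
  proof (rule tendstoI)
    fix e0 :: real assume "0 < e0"
    define e where "e = e0 / 4"
    have e: "0 < e" and e0: "e0 = 4 * e" using \<open>0 < e0\<close> by (simp_all add: e_def)
    have "(\<delta> (a + e) \<longlongrightarrow> \<rho> t (\<tau> - \<tau>') e) (at_right 0)"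
      using P_tendsto_strict[OF t a(1), of "a + e"] e by (simp add: \<delta>_def[abs_def])
    from tendstoD[OF this e] near[OF e]
    show "\<forall>\<^sub>F r in at_right 0. dist (\<delta> a r) (\<rho> t (\<tau> - \<tau>') 0) < e0"
    proof eventually_elim
      case (elim r)
      have "\<bar>\<rho> t (\<tau> - \<tau>') e - \<rho> t (\<tau> - \<tau>') 0\<bar> \<le> e"
        using rho_lipschitz[OF tU, of e 0 "\<tau> - \<tau>'" "\<tau> - \<tau>'"] rho_lipschitz[OF tU, of 0 e "\<tau> - \<tau>'" "\<tau> - \<tau>'"] e
        by simp
      then show ?case using elim e unfolding dist_real_def e0 by linarith
    qed
  qed
  then show ?thesis using True by (simp add: \<delta>_def[abs_def])
qed (use P_tendsto_strict[OF t a(1)] a in simp)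

lemma P_tendsto:
  assumes t: "t \<in> generic" and z: "0 \<le> snd z" "0 \<le> snd z'"
  shows "((\<lambda>r. dist (P t r z) (P t r z') / r) \<longlongrightarrow> N t (z' - z)) (at_right 0)"
proof (cases "snd z \<le> snd z'")
  case True
  then show ?thesis
    using P_tendsto_ordered[OF t z(1) True, of "fst z" "fst z'"] by (simp add: N_def)
next
  case False
  then show ?thesis
    using P_tendsto_ordered[OF t z(2), of "snd z" "fst z'" "fst z"]
    by (simp add: N_def dist_commute)
qed

text \<open>The inequalities hold at each small scale and pass to the limit. As the limits depend on
  differences only, all points may first be lifted by \<open>z\<close> into the upper
  half-plane.\<close>

lemma tangent_seminorm:
  assumes ptol: "ptolemy X" and t: "t \<in> generic"
  shows "ptolemy_seminorm (N t)"
proof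
  note tU = genericD[OF t]
  fix x y :: "real \<times> real"
  define z where "z = (0 :: real, \<bar>snd x\<bar> + \<bar>snd y\<bar>)"
  have nn: "0 \<le> snd z" "0 \<le> snd (z + x)" "0 \<le> snd (z + x + y)" by (auto simp: z_def)
  have "N t (z + x + y - z) \<le> N t (z + x - z) + N t (z + x + y - (z + x))"
  proof (rule tendsto_le[OF trivial_limit_at_right_real])
    show "((\<lambda>r. dist (P t r z) (P t r (z + x + y)) / r) \<longlongrightarrow> N t (z + x + y - z)) (at_right 0)"
      by (intro P_tendsto t nn)
    show "((\<lambda>r. dist (P t r z) (P t r (z + x)) / r + dist (P t r (z + x)) (P t r (z + x + y)) / r)
        \<longlongrightarrow> N t (z + x - z) + N t (z + x + y - (z + x))) (at_right 0)"
      by (intro tendsto_add P_tendsto t nn)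
    show "\<forall>\<^sub>F r in at_right 0. dist (P t r z) (P t r (z + x + y)) / r
        \<le> dist (P t r z) (P t r (z + x)) / r + dist (P t r (z + x)) (P t r (z + x + y)) / r"
      using eventually_small[OF zero_less_one]
    proof eventually_elim
      case (elim r)
      then show ?case
        using divide_right_mono[OF dist_triangle[of "P t r z" "P t r (z + x + y)" "P t r (z + x)"], of r]
        by (simp add: add_divide_distrib)
    qed
  qed
  then show "N t (x + y) \<le> N t x + N t y" by (simp add: algebra_simps)
next
  note tU = genericD[OF t]
  fix s :: real and x :: "real \<times> real"
  have pos: "N t (s *\<^sub>R x) = s * N t x" if "0 < s" for s
    using that rho_scale[OF tU, of "snd x" s "- fst x"] rho_scale[OF tU, of "- snd x" s "fst x"]
    by (auto simp: N_def zero_le_mult_iff)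
  show "N t (s *\<^sub>R x) = \<bar>s\<bar> * N t x"
  proof (cases s "0 :: real" rule: linorder_cases)
    case less
    then show ?thesis using pos[of "- s"] N_minus[OF tU, of "s *\<^sub>R x"] by simp
  next
    case equal
    then show ?thesis by (simp add: N_def rho_right[OF tU])
  qed (use pos in simp)
next
  note tU = genericD[OF t]
  fix x y u v :: "real \<times> real"
  define z where "z = (0 :: real, \<bar>snd x\<bar> + \<bar>snd y\<bar> + \<bar>snd u\<bar> + \<bar>snd v\<bar>)"
  have nn: "0 \<le> snd (z + x)" "0 \<le> snd (z + y)" "0 \<le> snd (z + u)" "0 \<le> snd (z + v)" by (auto simp: z_def)
  have lim: "((\<lambda>r. dist (P t r (z + a)) (P t r (z + b)) / r) \<longlongrightarrow> N t (a - b)) (at_right 0)"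
    if "0 \<le> snd (z + a)" "0 \<le> snd (z + b)" for a b
    using P_tendsto[OF t that] N_minus[OF tU, of "a - b"] by simp
  have in_X: "\<forall>\<^sub>F r in at_right 0. P t r (z + a) \<in> X" if "0 \<le> snd (z + a)" for a
    using eventually_valid[OF tU that, of "fst (z + a)"]
  proof eventually_elim
    case (elim r)
    then show ?case unfolding P_def using that by (intro R_in) auto
  qed
  show "N t (x - y) * N t (u - v) \<le> N t (x - u) * N t (y - v) + N t (x - v) * N t (y - u)"
  proof (rule tendsto_le[OF trivial_limit_at_right_real])
    let ?d = "\<lambda>a b r. dist (P t r (z + a)) (P t r (z + b)) / r"
    show "((\<lambda>r. ?d x y r * ?d u v r) \<longlongrightarrow> N t (x - y) * N t (u - v)) (at_right 0)"
      by (intro tendsto_mult lim nn)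
    show "((\<lambda>r. ?d x u r * ?d y v r + ?d x v r * ?d y u r)
        \<longlongrightarrow> N t (x - u) * N t (y - v) + N t (x - v) * N t (y - u)) (at_right 0)"
      by (intro tendsto_add tendsto_mult lim nn)
    show "\<forall>\<^sub>F r in at_right 0. ?d x y r * ?d u v r \<le> ?d x u r * ?d y v r + ?d x v r * ?d y u r"
      using in_X[OF nn(1)] in_X[OF nn(2)] in_X[OF nn(3)] in_X[OF nn(4)] eventually_small[OF zero_less_one]
    proof eventually_elim
      case (elim r)
      then have "dist (P t r (z + x)) (P t r (z + y)) * dist (P t r (z + u)) (P t r (z + v))
        \<le> dist (P t r (z + x)) (P t r (z + u)) * dist (P t r (z + y)) (P t r (z + v))
          + dist (P t r (z + x)) (P t r (z + v)) * dist (P t r (z + y)) (P t r (z + u))"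
        using ptol unfolding ptolemy_def by blast
      from divide_right_mono[OF this, of "r * r"] show ?case by (simp add: add_divide_distrib)
    qed
  qed
qed

lemma tangent_law_of_cosines:
  assumes ptol: "ptolemy X" and t: "t \<in> generic"
  obtains k where "\<And>T a. 0 \<le> a \<Longrightarrow> (\<rho> t T a)\<^sup>2 = T\<^sup>2 + a\<^sup>2 - 2 * k * T * a"
proof -
  note tU = genericD[OF t]
  interpret ptolemy_seminorm "N t" by (rule tangent_seminorm[OF ptol t])
  have "N t (1, 0) = 1" "N t (0, 1) = 1" using tU by (simp_all add: N_def rho_right rho_up)
  from quadratic[OF this] obtain k
    where k: "\<And>x y. (N t (x *\<^sub>R (1, 0) + y *\<^sub>R (0, 1)))\<^sup>2 = x\<^sup>2 + y\<^sup>2 + 2 * k * x * y" by blast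
  have "(\<rho> t T a)\<^sup>2 = T\<^sup>2 + a\<^sup>2 - 2 * k * T * a" if "0 \<le> a" for T a
    using k[of "- T" a] that by (simp add: N_def)
  then show ?thesis by (rule that)
qed

section \<open>The law of cosines at generic points\<close>

lemma rho_nonneg: "t \<in> U \<Longrightarrow> 0 \<le> a \<Longrightarrow> 0 \<le> \<rho> t T a"
  unfolding \<rho>_def using ok_exists[of t a T] by (intro cInf_greatest) (auto intro: q_nonneg)

text \<open>Busemann convexity with the constant geodesic at \<open>p\<close>.\<close>

lemma h_convex:
  assumes "0 \<le> u" "u \<le> L" "0 \<le> v" "v \<le> L" "0 \<le> l" "l \<le> 1"
  shows "h ((1 - l) * u + l * v) \<le> (1 - l) * h u + l * h v"
proof -
  define w where "w = (1 - l) * u + l * v"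
  have w: "0 \<le> w" "w \<le> L"
    using assms convexD_alt[OF convex_real_interval(5)[of 0 L], of u v l] by (simp_all add: w_def)
  have "u - w = l * (u - v)" "w - v = (1 - l) * (u - v)" by (simp_all add: w_def algebra_simps)
  then have "point_at X (c u) (c v) l (c w)"
    using assms w c_in by (simp add: point_at_def c_dist abs_mult)
  moreover have "point_at X p p l p" using p_in by (simp add: point_at_def)
  ultimately have "dist (c w) p \<le> (1 - l) * dist (c u) p + l * dist (c v) p"
    using assms c_in p_in by (intro busemann) auto
  then show ?thesis by (simp add: h_def w_def)
qed

text \<open>The constant \<open>k\<close> plays the role of the cosine of the angle at \<open>c t\<close> between \<open>c\<close> and the
  geodesic to \<open>p\<close>; the cosine law makes it symmetric in these two directions.\<close>

definition cosine :: "real \<Rightarrow> real \<Rightarrow> bool" where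
  "cosine t k \<longleftrightarrow> (\<forall>T a. 0 \<le> a \<longrightarrow> (\<rho> t T a)\<^sup>2 = T\<^sup>2 + a\<^sup>2 - 2 * k * T * a)"

lemma cosine_bound:
  assumes "cosine t k" shows "\<bar>k\<bar> \<le> 1"
proof -
  have "(\<rho> t 1 1)\<^sup>2 = 2 - 2 * k" "(\<rho> t (- 1) 1)\<^sup>2 = 2 + 2 * k"
    using assms by (simp_all add: cosine_def)
  then have "0 \<le> 2 - 2 * k" "0 \<le> 2 + 2 * k" by (metis zero_le_power2)+
  then show ?thesis by linarith
qed

lemma cosine_rho_lower:
  assumes k: "cosine t k" and t: "t \<in> U" and a: "0 \<le> a"
  shows "\<bar>T - k * a\<bar> \<le> \<rho> t T a"
proof (rule abs_le_square_iff[THEN iffD2, of _ "\<rho> t T a", unfolded abs_of_nonneg[OF rho_nonneg[OF t a]]])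
  have "(k * a)\<^sup>2 \<le> a\<^sup>2"
    using cosine_bound[OF k] a by (simp add: power_mult_distrib mult_left_le_one_le abs_square_le_1)
  then show "(T - k * a)\<^sup>2 \<le> (\<rho> t T a)\<^sup>2"
    using k a by (simp add: cosine_def power2_diff)
qed

text \<open>On the side of \<open>t\<close> away from \<open>s\<close>, a detour through a point far
  up the geodesic to \<open>p\<close> bounds \<open>h\<close> from above to first order. Convexity
  of \<open>h\<close> turns this into a lower bound at \<open>s\<close>.\<close>

lemma cosine_subgradient:
  assumes k: "cosine t k" and t: "t \<in> U" and s: "0 \<le> s" "s \<le> L"
  shows "h t - k * (s - t) \<le> h s"
proof (cases "s = t")
  case False
  define \<sigma> where "\<sigma> = - sgn (s - t)"
  define d where "d = \<bar>s - t\<bar>"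
  have d: "0 < d" using False by (simp add: d_def)
  have \<sigma>: "\<sigma>\<^sup>2 = 1" "\<bar>\<sigma>\<bar> = 1" "s = t - \<sigma> * d" "k * (s - t) = - (d * k * \<sigma>)"
    using False by (auto simp: \<sigma>_def d_def sgn_if)
  note k1 = cosine_bound[OF k]
  have k\<sigma>: "k * \<sigma> \<le> 1" using k1 \<sigma>(2) by (metis abs_le_D1 abs_mult mult.right_neutral)
  show ?thesis
  proof (rule field_le_epsilon)
    fix e0 :: real assume e0: "0 < e0"
    define e where "e = min (1 / 2) (e0 / (2 * d))"
    have e: "0 < e" "e \<le> 1 / 2" "e \<le> e0 / (2 * d)" using e0 d by (auto simp: e_def)
    have ed: "2 * e * d \<le> e0" using e(3) d by (simp add: pos_le_divide_eq algebra_simps)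
    \<comment> \<open>For large \<open>a\<close>, \<open>\<rho> t \<sigma> a\<close> is nearly
      \<open>a - k * \<sigma>\<close>; with \<open>2 * a * e = 1\<close> the square of the
      error-corrected value absorbs \<open>\<sigma>\<^sup>2\<close>.\<close>
    define a where "a = 1 / (2 * e)"
    have a: "1 \<le> a" "2 * a * e = 1" using e by (simp_all add: a_def)
    have "(\<rho> t \<sigma> a)\<^sup>2 \<le> (a - k * \<sigma> + e)\<^sup>2"
    proof -
      have "(a - k * \<sigma> + e)\<^sup>2 = a\<^sup>2 + 2 * a * e - 2 * k * \<sigma> * a + (e - k * \<sigma>)\<^sup>2"
        by (simp add: power2_eq_square algebra_simps)
      then show ?thesis using k a \<sigma>(1) by (simp add: cosine_def)
    qed
    then have "\<rho> t \<sigma> a \<le> a - k * \<sigma> + e"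
      by (rule power2_le_imp_le) (use a e k\<sigma> in linarith)
    then have "\<rho> t \<sigma> a < a - k * \<sigma> + 2 * e" using e by simp
    then obtain r where r: "ok r t \<sigma> a" "q r t \<sigma> a < a - k * \<sigma> + 2 * e"
      using rho_approx[OF t, of a \<sigma>] a by auto
    note o = okD[OF r(1)]
    have "dist (c (t + r * \<sigma>)) (R t (r * a)) < r * (a - k * \<sigma> + 2 * e)"
      using r(2) o(1) by (simp add: q_def pos_divide_less_eq mult.commute)
    then have near: "h (t + r * \<sigma>) \<le> h t + r * (2 * e - k * \<sigma>)"
      using dist_triangle[of "c (t + r * \<sigma>)" p "R t (r * a)"] dist_R_p[OF t o(7,6)]
      by (simp add: h_def algebra_simps)
    \<comment> \<open>The weight that makes \<open>t\<close> the convex combination of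
      \<open>s\<close> and \<open>t + r * \<sigma>\<close>.\<close>
    define l where "l = d / (d + r)"
    have l: "0 \<le> l" "l \<le> 1" "(d + r) * l = d" "(d + r) * (1 - l) = r"
      using d o(1) by (simp_all add: l_def field_simps)
    have t_eq: "(1 - l) * s + l * (t + r * \<sigma>) = t"
    proof -
      have "(d + r) * ((1 - l) * s + l * (t + r * \<sigma>)) = ((d + r) * (1 - l)) * s + ((d + r) * l) * (t + r * \<sigma>)"
        by (simp only: algebra_simps)
      also have "\<dots> = (d + r) * t" unfolding l(3,4) by (simp add: \<sigma>(3) algebra_simps)
      finally show ?thesis using d o(1) by simp
    qed
    have "h t \<le> (1 - l) * h s + l * h (t + r * \<sigma>)"
      using h_convex[OF s o(3,4) l(1,2)] unfolding t_eq .
    then have "(d + r) * h t \<le> (d + r) * ((1 - l) * h s + l * h (t + r * \<sigma>))"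
      using d o(1) by (intro mult_left_mono) auto
    also have "\<dots> = ((d + r) * (1 - l)) * h s + ((d + r) * l) * h (t + r * \<sigma>)"
      by (simp only: algebra_simps)
    also have "\<dots> = r * h s + d * h (t + r * \<sigma>)" unfolding l(3,4) ..
    also have "\<dots> \<le> r * h s + d * (h t + r * (2 * e - k * \<sigma>))"
      using near d by (intro add_left_mono mult_left_mono) auto
    finally have "r * h t \<le> r * (h s + d * (2 * e - k * \<sigma>))" by (simp add: algebra_simps)
    then have "h t \<le> h s + d * (2 * e - k * \<sigma>)" using o(1) by simp
    then show "h t - k * (s - t) \<le> h s + e0" unfolding \<sigma>(4) using ed by (simp add: algebra_simps)
  qed
qed simp

text \<open>Ptolemy's inequality for \<open>c s\<close>, \<open>c t\<close> and the points at fraction \<open>e\<close> of the way from them to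
  \<open>p\<close>, to first order in \<open>e\<close>.\<close>

lemma cosine_monotone:
  assumes ptol: "ptolemy X" and k: "cosine s k" "cosine t k'" and U: "s \<in> U" "t \<in> U" and st: "s < t"
  shows "t - s \<le> k * h s - k' * h t"
proof -
  note u = UD[OF U(1)] UD[OF U(2)]
  define A where "A = (t - s) * (k' * h t - k * h s) + (t - s)\<^sup>2"
  define B where "B = h s * h t * (1 + k * k')"
  have "A \<le> e * B" if e: "0 < e" "e \<le> 1" for e
  proof -
    define y where "y = R s (e * h s)"
    define z where "z = R t (e * h t)"
    have es: "0 \<le> e * h s" "e * h s \<le> h s" and et: "0 \<le> e * h t" "e * h t \<le> h t"
      using e by (simp_all add: mult_left_le_one_le)
    have X: "y \<in> X" "z \<in> X" using R_in U es et by (simp_all add: y_def z_def)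
    have d: "dist (c s) y = e * h s" "dist (c t) z = e * h t"
      using dist_c_R U es et by (simp_all add: y_def z_def)
    have "point_at X (c s) p e y" "point_at X (c t) p e z"
      using R_point_at[OF U(1) es] R_point_at[OF U(2) et] u by (simp_all add: y_def z_def)
    then have zy: "dist y z \<le> (1 - e) * (t - s)"
      using busemann[of "c s" p "c t" p e y z] e u p_in c_dist[of s t] st by simp
    \<comment> \<open>Scale 1 is the unscaled configuration, so \<open>\<rho>\<close> bounds the
      actual distance from below.\<close>
    have "\<rho> s (t - s) (e * h s) \<le> q 1 s (t - s) (e * h s)"
      using U u es by (intro rho_le) (simp add: ok_def)
    then have 1: "\<bar>t - s - k * (e * h s)\<bar> \<le> dist (c t) y"
      using cosine_rho_lower[OF k(1) U(1) es(1), of "t - s"] by (simp add: q_def y_def)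
    have "\<rho> t (s - t) (e * h t) \<le> q 1 t (s - t) (e * h t)"
      using U u et by (intro rho_le) (simp add: ok_def)
    then have 2: "\<bar>s - t - k' * (e * h t)\<bar> \<le> dist (c s) z"
      using cosine_rho_lower[OF k(2) U(2) et(1), of "s - t"] by (simp add: q_def z_def)
    have "(t - s - k * (e * h s)) * (t - s + k' * (e * h t))
        \<le> \<bar>s - t - k' * (e * h t)\<bar> * \<bar>t - s - k * (e * h s)\<bar>"
    proof -
      have "(t - s - k * (e * h s)) * (t - s + k' * (e * h t)) = - ((s - t - k' * (e * h t)) * (t - s - k * (e * h s)))"
        by (simp add: algebra_simps)
      then show ?thesis unfolding abs_mult[symmetric] by linarith
    qed
    also have "\<dots> \<le> dist (c s) z * dist (c t) y"
      using 1 2 by (intro mult_mono) auto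
    also have "\<dots> \<le> dist (c s) (c t) * dist z y + dist (c s) y * dist z (c t)"
      using ptol X u unfolding ptolemy_def by blast
    also have "\<dots> \<le> (t - s) * ((1 - e) * (t - s)) + e * h s * (e * h t)"
      using zy st c_dist[of s t] u d by (simp add: dist_commute mult_left_mono)
    finally have "e * A \<le> e * (e * B)"
      by (simp add: A_def B_def power2_eq_square algebra_simps)
    then show ?thesis using e by simp
  qed
  then have lim: "A \<le> e * B" if "0 < e" "e \<le> 1" for e using that by blast
  have "A \<le> 0"
  proof (rule tendsto_lowerbound)
    show "((\<lambda>e. e * B) \<longlongrightarrow> 0) (at_right 0)" by (auto intro!: tendsto_eq_intros)
    show "\<forall>\<^sub>F e in at_right 0. A \<le> e * B"
      using eventually_small[OF zero_less_one] by eventually_elim (use lim in blast)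
  qed simp
  moreover have "A = (t - s) * ((t - s) - (k * h s - k' * h t))"
    by (simp add: A_def power2_eq_square algebra_simps)
  ultimately show ?thesis using st by (simp add: mult_le_0_iff)
qed

lemma half_square_strongly_convex:
  assumes ptol: "ptolemy X" and t: "0 \<le> t" "t \<le> L"
  shows "L * (h t)\<^sup>2 \<le> (L - t) * (h 0)\<^sup>2 + t * (h L)\<^sup>2 - L * t * (L - t)"
proof -
  have "\<exists>k. t \<in> generic \<longrightarrow> cosine t k" for t
    using tangent_law_of_cosines[OF ptol] unfolding cosine_def by metis
  then obtain k where k: "\<And>t. t \<in> generic \<Longrightarrow> cosine t (k t)" by metis
  have "L * ((h t)\<^sup>2 / 2) \<le> (L - t) * ((h 0)\<^sup>2 / 2) + t * ((h L)\<^sup>2 / 2) - L * t * (L - t) / 2"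
  proof (rule strongly_convex_by_density[where D=generic and G="\<lambda>t. - (k t * h t)"])
    show "continuous_on {0..L} (\<lambda>t. (h t)\<^sup>2 / 2)"
      by (intro continuous_intros continuous_h) simp
    show "\<exists>d\<in>generic. y < d \<and> d < z" if "0 \<le> y" "y < z" "z \<le> L" for y z
      by (rule generic_dense[OF that])
    show "generic \<subseteq> {0..L}" using genericD UD by (meson atLeastAtMost_iff less_imp_le subsetI)
    show "(h d)\<^sup>2 / 2 + - (k d * h d) * (s - d) \<le> (h s)\<^sup>2 / 2"
      if d: "d \<in> generic" and s: "0 \<le> s" "s \<le> L" for d s
    proof -
      \<comment> \<open>The chain rule for half the square: the subgradient of \<open>h\<close> is
        multiplied by \<open>h d\<close>, and the product \<open>h d * h s\<close> is at most the
        mean of the squares.\<close>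
      have "h d * (h d - k d * (s - d)) \<le> h d * h s"
        using cosine_subgradient[OF k[OF d] genericD[OF d] s] by (intro mult_left_mono) auto
      moreover have "0 \<le> (h s - h d)\<^sup>2" by simp
      ultimately show ?thesis by (simp add: power2_eq_square algebra_simps)
    qed
    show "e - d \<le> - (k e * h e) - - (k d * h d)" if "d \<in> generic" "e \<in> generic" "d < e" for d e
      using cosine_monotone[OF ptol k k, of d e] that genericD by simp
  qed (use t in auto)
  then show ?thesis by (simp add: field_simps)
qed

end

section \<open>From Ptolemy's inequality and Busemann convexity to Stewart's inequality\<close>

lemma ptolemy_busemann_imp_stewart:
  assumes ptol: "ptolemy X" and bus: "busemann_convex X"
  shows "stewart X"
  unfolding stewart_def
proof (intro ballI allI impI)
  fix x y z l m
  assume X: "x \<in> X" "y \<in> X" "z \<in> X" and l: "l \<in> {0..1::real}" and m: "point_at X y z l m"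
  have geo: "geodesic_space X" using bus by (simp add: busemann_convex_def)
  define pt where "pt x y l = (SOME m. point_at X x y l m)" for x y l
  interpret busemann_geodesics X pt
  proof
    show "point_at X x y l (pt x y l)" if "x \<in> X" "y \<in> X" "0 \<le> l" "l \<le> 1" for x y l
      unfolding pt_def using point_at_exists[OF geo that] by (metis someI)
  qed (rule busemann_point_at[OF bus])
  define L where "L = dist y z"
  obtain \<gamma> where \<gamma>: "geodesic_path X y z \<gamma>" "\<gamma> (l * L) = m"
    using geodesic_path_through[OF geo X(2,3) m] unfolding L_def .
  note g = geodesic_pathD[OF \<gamma>(1), folded L_def]
  interpret geodesic_and_point X pt \<gamma> L x
    by unfold_locales (use g(1,2) X in auto)
  have "L * (h (l * L))\<^sup>2 \<le> (L - l * L) * (h 0)\<^sup>2 + l * L * (h L)\<^sup>2 - L * (l * L) * (L - l * L)"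
    using l by (intro half_square_strongly_convex[OF ptol]) (auto simp: L_def mult_left_le_one_le)
  moreover have "h (l * L) = dist x m" "h 0 = dist x y" "h L = dist x z"
    using \<gamma>(2) g(3,4) by (simp_all add: h_def dist_commute)
  ultimately have *: "L * (dist x m)\<^sup>2 \<le> L * ((1 - l) * (dist x y)\<^sup>2 + l * (dist x z)\<^sup>2 - l * (1 - l) * L\<^sup>2)"
    by (simp add: power2_eq_square algebra_simps)
  show "(dist x m)\<^sup>2 \<le> (1 - l) * (dist x y)\<^sup>2 + l * (dist x z)\<^sup>2 - l * (1 - l) * (dist y z)\<^sup>2"
  \<comment> \<open>The inequality obtained carries a factor \<open>L\<close>; if it vanishes, the
    three points \<open>y\<close>, \<open>z\<close>, \<open>m\<close> coincide.\<close>
  proof (cases "L = 0")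
    case True
    have "dist y m = l * L" using m unfolding point_at_def L_def by blast
    then have "m = y" using True by simp
    have "z = y" using True by (simp add: L_def)
    then show ?thesis using \<open>m = y\<close> by (simp add: algebra_simps)
  next
    case False
    then have "0 < L" by (simp add: L_def)
    then show ?thesis using * by (simp add: L_def)
  qed
qed

theorem theorem1p3:
  fixes X :: "'a::metric_space set"
  shows "CAT0_space X \<longleftrightarrow> ptolemy X \<and> busemann_convex X"
proof
  assume cat: "CAT0_space X"
  then have "geodesic_space X" "stewart X"
    using CAT0_space_imp_stewart by (auto simp: CAT0_space_def)
  then show "ptolemy X \<and> busemann_convex X"
    using stewart_imp_ptolemy stewart_imp_busemann_convex by blast
next
  assume "ptolemy X \<and> busemann_convex X"
  then show "CAT0_space X"
    using ptolemy_busemann_imp_stewart stewart_imp_CAT0_space by (auto simp: busemann_convex_def)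
qed

end
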